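(* Let $k\in\mathbb{N}$. (i) If $f\in{\mathsf{SF}}^{\mathrm{fin}}(\overline k)$ and $f\prec f'$ (with $f'\in{\mathsf{SF}}(\overline k)$), then there exists $f''\in{\mathsf{SF}}(\overline k)$ with $f''\,\sharp\,f'$ and $f\prec f''$. (ii) If $\Phi\in{\mathsf{SF}}(\overline k\rightarrow\overline k)$ and $\Phi\succeq\mathit{id}$, there can be no $f\in{\mathsf{SF}}(\overline k)$ with $\Phi(f)\succ f$; hence $\Phi=\mathit{id}$.
   Context: Pure types $\overline0=\mathbb{N}$, $\overline{k+1}=\overline k\rightarrow\mathbb{N}$. ${\mathsf{SF}}(\sigma)$ is the set of closed ${\mathrm{PCF}}^\Omega$ terms of type $\sigma$ modulo observational equivalence (${\mathrm{PCF}}^\Omega$: simply typed $\lambda$-calculus over $\mathbb{N}$ with constants $\underline n,\mathit{suc},\mathit{pre},\mathit{ifzero}$, $Y_\sigma$ for all $\sigma$, and $C_f$ for each partial $f:\mathbb{N}\rightharpoonup\mathbb{N}$; $M\simeq M'$ iff all closed contexts of type $\mathbb{N}$ yield the same numeral, if any); it is extensional, ${\mathsf{SF}}(\mathbb{N})\cong\mathbb{N}_\bot$, and elements of ${\mathsf{SF}}(\sigma\rightarrow\tau)$ are regarded as functions. $\preceq$ is the extensional order: $x\preceq x'$ iff $h\cdot x\sqsubseteq h\cdot x'$ for all $h\in{\mathsf{SF}}(\sigma\rightarrow\mathbb{N})$ (flat order on $\mathbb{N}_\bot$); it is pointwise at function types. $f\prec f'$ means $f\preceq f'$ and $f\ne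 f'$; $f\,\sharp\,f'$ means $f,f'$ have no upper bound w.r.t. $\preceq$. $\mathit{id}$ is the identity. Every element of ${\mathsf{SF}}$ is the observational-equivalence class of the interpretation of a closed ${\mathrm{PCF}}^\Omega$ term as a nested sequential procedure (NSP): a possibly infinite well-typed tree generated by $p::=\lambda\vec x.e$, $e::=\bot\mid n\mid\mathtt{case}\ a\ \mathtt{of}\ (i\Rightarrow e_i\mid i\in\mathbb{N})$, $a::=x\,q_0\cdots q_{r-1}$. An NSP is finite if it is a finite tree once all branches of the form $i\Rightarrow\bot$ are deleted; $f\in{\mathsf{SF}}(\sigma)$ is finite, $f\in{\mathsf{SF}}^{\mathrm{fin}}(\sigma)$, if it is represented by some finite closed NSP. *)

theory Defs
  imports Main
begin

datatype ty = N | Arr ty ty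

fun pure :: "nat \<Rightarrow> ty" where
  "pure 0 = N"
| "pure (Suc k) = Arr (pure k) N"

datatype tm =
    Var nat
  | Lam ty tm
  | App tm tm
  | Num nat
  | Succ
  | Pred
  | Ifz
  | Fix ty
  | Cst "nat \<Rightarrow> nat option"

inductive typing :: "ty list \<Rightarrow> tm \<Rightarrow> ty \<Rightarrow> bool" where
  T_Var: "i < length \<Gamma> \<Longrightarrow> \<Gamma> ! i = T \<Longrightarrow> typing \<Gamma> (Var i) T"
| T_Lam: "typing (T # \<Gamma>) b U \<Longrightarrow> typing \<Gamma> (Lam T b) (Arr T U)"
| T_App: "typing \<Gamma> f (Arr T U) \<Longrightarrow> typing \<Gamma> a T \<Longrightarrow> typing \<Gamma> (App f a) U"
| T_Num: "typing \<Gamma> (Num n) N"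
| T_Succ: "typing \<Gamma> Succ (Arr N N)"
| T_Pred: "typing \<Gamma> Pred (Arr N N)"
| T_Ifz: "typing \<Gamma> Ifz (Arr N (Arr N (Arr N N)))"
| T_Fix: "typing \<Gamma> (Fix T) (Arr (Arr T T) T)"
| T_Cst: "typing \<Gamma> (Cst f) (Arr N N)"

fun lift :: "tm \<Rightarrow> nat \<Rightarrow> tm" where
  "lift (Var i) k = (if i < k then Var i else Var (Suc i))"
| "lift (Lam T t) k = Lam T (lift t (Suc k))"
| "lift (App s t) k = App (lift s k) (lift t k)"
| "lift t k = t"

fun subst :: "tm \<Rightarrow> tm \<Rightarrow> nat \<Rightarrow> tm" where
  "subst (Var i) s k = (if k < i then Var (i - 1) else if i = k then s else Var i)"
| "subst (Lam T t) s k = Lam T (subst t (lift s 0) (Suc k))"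
| "subst (App t u) s k = App (subst t s k) (subst u s k)"
| "subst t s k = t"

inductive step :: "tm \<Rightarrow> tm \<Rightarrow> bool" where
  S_Beta: "step (App (Lam T b) a) (subst b a 0)"
| S_Fix: "step (App (Fix T) f) (App f (App (Fix T) f))"
| S_Succ: "step (App Succ (Num n)) (Num (Suc n))"
| S_Pred: "step (App Pred (Num n)) (Num (n - 1))"
| S_Ifz0: "step (App (App (App Ifz (Num 0)) a) b) a"
| S_IfzS: "step (App (App (App Ifz (Num (Suc n))) a) b) b"
| S_Cst: "f n = Some m \<Longrightarrow> step (App (Cst f) (Num n)) (Num m)"
| S_AppL: "step s s' \<Longrightarrow> step (App s t) (App s' t)"
| S_SuccA: "step s s' \<Longrightarrow> step (App Succ s) (App Succ s')"
| S_PredA: "step s s' \<Longrightarrow> step (App Pred s) (App Pred s')"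
| S_CstA: "step s s' \<Longrightarrow> step (App (Cst f) s) (App (Cst f) s')"
| S_IfzA: "step s s' \<Longrightarrow> step (App (App (App Ifz s) a) b) (App (App (App Ifz s') a) b)"

definition evals :: "tm \<Rightarrow> nat \<Rightarrow> bool" where
  "evals M n \<longleftrightarrow> step\<^sup>*\<^sup>* M (Num n)"

definition closed_of :: "ty \<Rightarrow> tm \<Rightarrow> bool" where
  "closed_of \<sigma> M \<longleftrightarrow> typing [] M \<sigma>"

datatype ctx = Hole | CLam ty ctx | CAppL ctx tm | CAppR tm ctx

fun plug :: "ctx \<Rightarrow> tm \<Rightarrow> tm" where
  "plug Hole M = M"
| "plug (CLam T C) M = Lam T (plug C M)"
| "plug (CAppL C t) M = App (plug C M) t"
| "plug (CAppR t C) M = App t (plug C M)"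

text \<open>Observational equivalence of closed terms of type sigma: all closed contexts
  of type N yield the same numeral, if any. Equality in SF(sigma).\<close>
definition obseq :: "ty \<Rightarrow> tm \<Rightarrow> tm \<Rightarrow> bool" where
  "obseq \<sigma> M M' \<longleftrightarrow> closed_of \<sigma> M \<and> closed_of \<sigma> M' \<and>
     (\<forall>C n. typing [] (plug C M) N \<longrightarrow> typing [] (plug C M') N \<longrightarrow>
        (evals (plug C M) n \<longleftrightarrow> evals (plug C M') n))"

definition sf_le :: "ty \<Rightarrow> tm \<Rightarrow> tm \<Rightarrow> bool" where
  "sf_le \<sigma> x x' \<longleftrightarrow> closed_of \<sigma> x \<and> closed_of \<sigma> x' \<and>
     (\<forall>h n. closed_of (Arr \<sigma> N) h \<longrightarrow> evals (App h x) n \<longrightarrow> evals (App h x') n)"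

definition sf_less :: "ty \<Rightarrow> tm \<Rightarrow> tm \<Rightarrow> bool" where
  "sf_less \<sigma> x x' \<longleftrightarrow> sf_le \<sigma> x x' \<and> \<not> obseq \<sigma> x x'"

definition sf_incompat :: "ty \<Rightarrow> tm \<Rightarrow> tm \<Rightarrow> bool" where
  "sf_incompat \<sigma> x x' \<longleftrightarrow> \<not> (\<exists>g. closed_of \<sigma> g \<and> sf_le \<sigma> x g \<and> sf_le \<sigma> x' g)"

definition idt :: "ty \<Rightarrow> tm" where
  "idt \<sigma> = Lam \<sigma> (Var 0)"

text \<open>Finite NSPs (branches i => bot deleted): a procedure binds a list of variables
  (de Bruijn, one binder per variable) over an expression; an expression is bot, a
  numeral, or case x q_0 ... q_{r-1} of finitely many branches i => e_i.\<close>
datatype nsp = PLam "ty list" exp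
  and exp = EBot | ENum nat | ECase nat "nsp list" "(nat \<times> exp) list"

definition bot_tm :: tm where
  "bot_tm = App (Cst Map.empty) (Num 0)"

definition eq_test :: "nat \<Rightarrow> tm" where
  "eq_test i = Cst (\<lambda>n. Some (if n = i then 0 else 1))"

fun case_chain :: "tm \<Rightarrow> (nat \<times> tm) list \<Rightarrow> tm" where
  "case_chain a [] = bot_tm"
| "case_chain a ((i, e) # bs) =
     App (App (App Ifz (App (eq_test i) a)) e) (case_chain a bs)"

fun lams :: "ty list \<Rightarrow> tm \<Rightarrow> tm" where
  "lams [] t = t"
| "lams (T # Ts) t = Lam T (lams Ts t)"

primrec nsp_tm :: "nsp \<Rightarrow> tm" and exp_tm :: "exp \<Rightarrow> tm" where
  "nsp_tm (PLam Ts e) = lams Ts (exp_tm e)"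
| "exp_tm EBot = bot_tm"
| "exp_tm (ENum n) = Num n"
| "exp_tm (ECase x qs bs) =
     case_chain (foldl App (Var x) (map nsp_tm qs)) (map (map_prod id exp_tm) bs)"

definition sf_fin :: "ty \<Rightarrow> tm \<Rightarrow> bool" where
  "sf_fin \<sigma> f \<longleftrightarrow> closed_of \<sigma> f \<and> (\<exists>p. closed_of \<sigma> (nsp_tm p) \<and> obseq \<sigma> f (nsp_tm p))"

end

theory Submission
  imports Defs "HOL.Filter"
begin

text \<open>
  The idea is to let a fresh numeral d stand for divergence. Every closed term t has a translation
  t^d in which all constants are total, d is propagated by all of them, and recursion is unrolled
  d times starting from d; a finite procedure p gets p^d by replacing every divergent leaf and
  missing branch by d, so that p is below p^d. A logical relation shows that if h x diverges, then
  h^d x^d evaluates to d; a second, step-indexed one shows that if h x evaluates to n, then so does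
  h^d x for all large d.

  Now let f be finite and f strictly below f'. Some h has h f' = n while h f diverges. For large d,
  h^d f' = n and h^d f^d = d, which differs from n, so f^d lies above f and is incompatible with f'.
  If Phi is above the identity and f strictly below Phi f, choose h with h (Phi f) = n and h f
  divergent: for large d we get h^d (Phi f^d) = n, but also h^d (Phi f^d) = d since Phi f^d is above
  f^d. Hence Phi f = f for all f, and extensionality (again through the logical relation)
  gives Phi = id. No induction on the type level is involved.
\<close>

section \<open>Closed terms and simultaneous closing substitution\<close>

section \<open>Typing\<close>

inductive_cases typing_VarE: "typing \<Gamma> (Var i) T"
inductive_cases typing_LamE: "typing \<Gamma> (Lam S b) T"
inductive_cases typing_AppE: "typing \<Gamma> (App f a) T"
inductive_cases typing_NumE: "typing \<Gamma> (Num n) T"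
inductive_cases typing_SuccE: "typing \<Gamma> Succ T"
inductive_cases typing_PredE: "typing \<Gamma> Pred T"
inductive_cases typing_IfzE: "typing \<Gamma> Ifz T"
inductive_cases typing_FixE: "typing \<Gamma> (Fix S) T"
inductive_cases typing_CstE: "typing \<Gamma> (Cst f) T"

lemmas typing_elims = typing_VarE typing_LamE typing_AppE typing_NumE typing_SuccE
  typing_PredE typing_IfzE typing_FixE typing_CstE

lemma typing_unique: "typing \<Gamma> t T \<Longrightarrow> typing \<Gamma> t T' \<Longrightarrow> T = T'"
  by (induction arbitrary: T' rule: typing.induct) (blast elim: typing_elims)+

lemma typing_append: "typing \<Gamma> t T \<Longrightarrow> typing (\<Gamma> @ \<Delta>) t T"
  by (induction rule: typing.induct) (auto intro: typing.intros simp: nth_append)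

lemma typing_closed: "typing [] t T \<Longrightarrow> typing \<Gamma> t T"
  using typing_append[of "[]"] by simp

lemma lift_typed: "typing \<Gamma> t T \<Longrightarrow> length \<Gamma> \<le> k \<Longrightarrow> lift t k = t"
  by (induction arbitrary: k rule: typing.induct) auto

lemma subst_typed: "typing \<Gamma> t T \<Longrightarrow> length \<Gamma> \<le> k \<Longrightarrow> subst t s k = t"
  by (induction arbitrary: k s rule: typing.induct) auto

lemma lift_closed: "typing [] t T \<Longrightarrow> lift t k = t"
  by (simp add: lift_typed)

lemma subst_closed: "typing [] t T \<Longrightarrow> subst t s k = t"
  by (simp add: subst_typed)

text \<open>The entries of \<open>\<sigma>\<close> are meant to be closed, so they go under binders
  without lifting; \<open>k\<close> counts the binders crossed.\<close>

fun inst :: "tm list \<Rightarrow> nat \<Rightarrow> tm \<Rightarrow> tm" where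
  "inst \<sigma> k (Var i) = (if i < k then Var i else \<sigma> ! (i - k))"
| "inst \<sigma> k (Lam T t) = Lam T (inst \<sigma> (Suc k) t)"
| "inst \<sigma> k (App s t) = App (inst \<sigma> k s) (inst \<sigma> k t)"
| "inst \<sigma> k t = t"

lemma inst_typed: "typing \<Gamma> t T \<Longrightarrow> length \<Gamma> \<le> k \<Longrightarrow> inst \<sigma> k t = t"
  by (induction arbitrary: k rule: typing.induct) auto

lemma inst_closed: "typing [] t T \<Longrightarrow> inst \<sigma> k t = t"
  by (simp add: inst_typed)

lemma typing_inst:
  assumes "typing (\<Delta> @ \<Gamma>) t T"
    and "\<And>i. i < length \<Gamma> \<Longrightarrow> typing [] (\<sigma> ! i) (\<Gamma> ! i)"
  shows "typing \<Delta> (inst \<sigma> (length \<Delta>) t) T"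
  using assms(1)
proof (induction t arbitrary: \<Delta> T)
  case (Var i)
  then have i: "i < length (\<Delta> @ \<Gamma>)" "(\<Delta> @ \<Gamma>) ! i = T"
    by (auto elim: typing_VarE)
  show ?case
  proof (cases "i < length \<Delta>")
    case True
    then show ?thesis using i by (auto simp: nth_append intro: typing.intros)
  next
    case False
    then show ?thesis
      using i assms(2)[of "i - length \<Delta>"] by (auto simp: nth_append intro: typing_closed)
  qed
next
  case (Lam S t)
  then obtain U where "T = Arr S U" "typing ((S # \<Delta>) @ \<Gamma>) t U"
    by (auto elim: typing_LamE)
  with Lam.IH[of "S # \<Delta>" U] show ?case by (auto intro: typing.intros)
next
  case (App t1 t2)
  from App.prems obtain S where "typing (\<Delta> @ \<Gamma>) t1 (Arr S T)" "typing (\<Delta> @ \<Gamma>) t2 S"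
    by (rule typing_AppE)
  then show ?case using App.IH T_App by (metis inst.simps(3))
qed (auto intro: typing.intros elim: typing_elims)

text \<open>This links a beta step to environments: substituting for the bound variable amounts to
  one more entry in front. The entries already inserted are closed, so \<open>subst\<close> passes
  over them.\<close>

lemma subst_inst:
  assumes "typing (\<Delta> @ T # \<Gamma>) t U" and "typing [] a T"
    and "\<And>i. i < length \<Gamma> \<Longrightarrow> typing [] (\<sigma> ! i) (\<Gamma> ! i)"
  shows "subst (inst \<sigma> (Suc (length \<Delta>)) t) a (length \<Delta>) = inst (a # \<sigma>) (length \<Delta>) t"
  using assms(1)
proof (induction t arbitrary: \<Delta> U)
  case (Var i)
  then have i: "i < length \<Delta> + Suc (length \<Gamma>)"
    by (auto elim: typing_VarE)
  show ?case
  proof (cases "i > length \<Delta>")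
    case True
    then have "typing [] (\<sigma> ! (i - Suc (length \<Delta>))) (\<Gamma> ! (i - Suc (length \<Delta>)))"
      using i assms(3) by auto
    with True show ?thesis by (auto simp: subst_closed nth_Cons')
  qed auto
next
  case (Lam S t)
  then obtain V where "typing ((S # \<Delta>) @ T # \<Gamma>) t V"
    by (auto elim: typing_LamE)
  with Lam.IH[of "S # \<Delta>" V] assms(2) show ?case by (auto simp: lift_closed)
next
  case (App t1 t2)
  then show ?case by (auto elim!: typing_AppE)
qed auto


section \<open>Deterministic call-by-name evaluation with step counts\<close>

section \<open>Evaluation\<close>

text \<open>Pairs each strict unary constant with the partial function that it computes, so that
  later arguments treat the three kinds uniformly.\<close>

inductive prim :: "tm \<Rightarrow> (nat \<Rightarrow> nat option) \<Rightarrow> bool" where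
  "prim Succ (\<lambda>n. Some (Suc n))"
| "prim Pred (\<lambda>n. Some (n - 1))"
| "prim (Cst f) f"

inductive_cases step_VarE: "step (Var i) s"
inductive_cases step_LamE: "step (Lam T b) s"
inductive_cases step_NumE: "step (Num n) s"
inductive_cases step_SuccE: "step Succ s"
inductive_cases step_PredE: "step Pred s"
inductive_cases step_IfzE: "step Ifz s"
inductive_cases step_FixE: "step (Fix T) s"
inductive_cases step_CstE: "step (Cst f) s"
inductive_cases step_AppE: "step (App t u) s"
inductive_cases step_IfzAppE: "step (App Ifz u) s"
inductive_cases step_IfzAppAppE: "step (App (App Ifz u) v) s"

lemmas step_elims = step_VarE step_LamE step_NumE step_SuccE step_PredE step_IfzE step_FixE step_CstE

lemma not_step_atom [simp]:
  "\<not> step (Var i) s" "\<not> step (Lam T b) s" "\<not> step (Num n) s" "\<not> step Succ s" "\<not> step Pred s"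
  "\<not> step Ifz s" "\<not> step (Fix T) s" "\<not> step (Cst f) s"
  by (auto elim: step_elims)

lemma not_step_Ifz_App [simp]: "\<not> step (App Ifz u) s" "\<not> step (App (App Ifz u) v) s"
  by (auto elim!: step_IfzAppE step_IfzAppAppE)

lemma step_deterministic: "step t s \<Longrightarrow> step t s' \<Longrightarrow> s = s'"
proof (induction arbitrary: s' rule: step.induct)
  case (S_AppL s u t)
  from S_AppL.prems show ?case
    by (rule step_AppE) (use S_AppL.hyps in \<open>auto dest: S_AppL.IH\<close>)
next
  case (S_SuccA s u)
  from S_SuccA.prems show ?case
    by (rule step_AppE) (use S_SuccA.hyps in \<open>auto dest: S_SuccA.IH\<close>)
next
  case (S_PredA s u)
  from S_PredA.prems show ?case
    by (rule step_AppE) (use S_PredA.hyps in \<open>auto dest: S_PredA.IH\<close>)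
next
  case (S_CstA s u f)
  from S_CstA.prems show ?case
    by (rule step_AppE) (use S_CstA.hyps in \<open>auto dest: S_CstA.IH\<close>)
next
  case (S_IfzA s u a b)
  from S_IfzA.prems show ?case
    by (rule step_AppE) (use S_IfzA.hyps in \<open>auto dest: S_IfzA.IH\<close>)
qed (erule step_AppE; auto; fail)+

lemma step_prim: "prim c \<phi> \<Longrightarrow> \<phi> n = Some m \<Longrightarrow> step (App c (Num n)) (Num m)"
  by (auto elim!: prim.cases intro: step.intros)

lemma step_prim_arg: "prim c \<phi> \<Longrightarrow> step s s' \<Longrightarrow> step (App c s) (App c s')"
  by (auto elim!: prim.cases intro: step.intros)

lemma step_prim_cases:
  assumes "prim c \<phi>" and "step (App c s) u"
  obtains s' where "step s s'" and "u = App c s'"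
  | n m where "s = Num n" and "\<phi> n = Some m" and "u = Num m"
  using assms(2,1) by (elim step_AppE; elim prim.cases; force)

lemma step_Ifz_cases:
  assumes "step (App (App (App Ifz s) a) b) u"
  obtains s' where "step s s'" and "u = App (App (App Ifz s') a) b"
  | n where "s = Num n" and "u = (if n = 0 then a else b)"
  using assms by (elim step_AppE) auto

lemma steps_prim_arg: "prim c \<phi> \<Longrightarrow> step\<^sup>*\<^sup>* s s' \<Longrightarrow> step\<^sup>*\<^sup>* (App c s) (App c s')"
  by (rotate_tac, induction rule: rtranclp_induct) (auto intro: step_prim_arg rtranclp.rtrancl_into_rtrancl)

lemma steps_AppL: "step\<^sup>*\<^sup>* s s' \<Longrightarrow> step\<^sup>*\<^sup>* (App s a) (App s' a)"
  by (induction rule: rtranclp_induct) (auto intro: S_AppL rtranclp.rtrancl_into_rtrancl)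

lemma steps_Ifz_arg:
  "step\<^sup>*\<^sup>* s s' \<Longrightarrow> step\<^sup>*\<^sup>* (App (App (App Ifz s) a) b) (App (App (App Ifz s') a) b)"
  by (induction rule: rtranclp_induct) (auto intro: S_IfzA rtranclp.rtrancl_into_rtrancl)

lemma evals_Num: "evals (Num n) n"
  by (simp add: evals_def)

lemma evals_step: "step t s \<Longrightarrow> evals s n \<Longrightarrow> evals t n"
  by (simp add: evals_def converse_rtranclp_into_rtranclp)

lemma evals_steps: "step\<^sup>*\<^sup>* t s \<Longrightarrow> evals s n \<Longrightarrow> evals t n"
  by (simp add: evals_def)

lemma evals_stepD: "evals t n \<Longrightarrow> step t s \<Longrightarrow> evals s n"
  unfolding evals_def by (metis converse_rtranclpE not_step_atom(3) step_deterministic)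

lemma evals_step_iff: "step t s \<Longrightarrow> evals t n \<longleftrightarrow> evals s n"
  using evals_step evals_stepD by blast

lemma evals_unique:
  assumes "evals t m" and "evals t n"
  shows "m = n"
proof -
  have "step\<^sup>*\<^sup>* t (Num m)" using assms(1) by (simp add: evals_def)
  then have "evals (Num m) n"
    using assms(2) by (induction rule: converse_rtranclp_induct) (auto dest: evals_stepD)
  then show ?thesis
    unfolding evals_def by (auto elim: converse_rtranclpE)
qed

lemma evals_relpowp: "(step ^^ l) t (Num n) \<Longrightarrow> evals t n"
  by (simp add: evals_def relpowp_imp_rtranclp)

lemma evals_prim: "prim c \<phi> \<Longrightarrow> evals s n \<Longrightarrow> \<phi> n = Some m \<Longrightarrow> evals (App c s) m"
  unfolding evals_def by (meson rtranclp.rtrancl_into_rtrancl step_prim steps_prim_arg)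

lemma evals_Ifz:
  assumes "evals s i" and "evals (if i = 0 then a else b) n"
  shows "evals (App (App (App Ifz s) a) b) n"
proof -
  have "step (App (App (App Ifz (Num i)) a) b) (if i = 0 then a else b)"
    by (cases i) (auto intro: step.intros)
  then show ?thesis
    using assms(1) assms(2) evals_step evals_steps steps_Ifz_arg unfolding evals_def[of s] by blast
qed

text \<open>A step bound for the whole evaluation also bounds that of the argument, so that
  step-indexed relatedness of the argument can be used.\<close>

lemma relpowp_step_prim:
  assumes "prim c \<phi>"
  shows "(step ^^ l) (App c s) (Num m) \<Longrightarrow> \<exists>n j. j \<le> l \<and> (step ^^ j) s (Num n) \<and> \<phi> n = Some m"
proof (induction l arbitrary: s)
  case (Suc l)
  then obtain u where u: "step (App c s) u" "(step ^^ l) u (Num m)"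
    by (meson relpowp_Suc_E2)
  from assms u(1) show ?case
  proof (cases rule: step_prim_cases)
    case (1 s')
    then obtain n j where "j \<le> l" "(step ^^ j) s' (Num n)" "\<phi> n = Some m"
      using Suc.IH u(2) by blast
    with 1 show ?thesis by (meson Suc_le_mono relpowp_Suc_I2)
  next
    case (2 n m')
    with u(2) have "m' = m"
      using evals_Num evals_relpowp evals_unique by blast
    with 2 show ?thesis by (intro exI[of _ n] exI[of _ 0]) auto
  qed
qed auto

lemma relpowp_step_Ifz:
  "(step ^^ l) (App (App (App Ifz s) a) b) (Num m) \<Longrightarrow>
    \<exists>n j j'. j \<le> l \<and> j' \<le> l \<and> (step ^^ j) s (Num n) \<and> (step ^^ j') (if n = 0 then a else b) (Num m)"
proof (induction l arbitrary: s)
  case (Suc l)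
  then obtain u where u: "step (App (App (App Ifz s) a) b) u" "(step ^^ l) u (Num m)"
    by (meson relpowp_Suc_E2)
  from u(1) show ?case
  proof (cases rule: step_Ifz_cases)
    case (1 s')
    then obtain n j j' where "j \<le> l" "j' \<le> l" "(step ^^ j) s' (Num n)"
      "(step ^^ j') (if n = 0 then a else b) (Num m)"
      using Suc.IH u(2) by blast
    with 1 show ?thesis by (meson Suc_le_mono relpowp_Suc_I2 le_SucI)
  next
    case (2 n)
    with u(2) show ?thesis by (intro exI[of _ n] exI[of _ 0] exI[of _ l]) auto
  qed
qed auto


section \<open>A scheme of relations between terms and families, and its fundamental lemma\<close>

section \<open>Step-indexed logical relations\<close>

definition typed_pair :: "ty \<Rightarrow> tm \<Rightarrow> (nat \<Rightarrow> tm) \<Rightarrow> bool" where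
  "typed_pair T t t' \<longleftrightarrow> typing [] t T \<and> (\<forall>w. typing [] (t' w) T)"

fun is_const :: "tm \<Rightarrow> bool" where
  "is_const (Var i) = False"
| "is_const (Lam T t) = False"
| "is_const (App s t) = False"
| "is_const t = True"

fun map_const :: "(tm \<Rightarrow> tm) \<Rightarrow> tm \<Rightarrow> tm" where
  "map_const \<theta> (Var i) = Var i"
| "map_const \<theta> (Lam T t) = Lam T (map_const \<theta> t)"
| "map_const \<theta> (App s t) = App (map_const \<theta> s) (map_const \<theta> t)"
| "map_const \<theta> t = \<theta> t"

lemma typing_is_const: "is_const c \<Longrightarrow> typing \<Gamma> c T \<Longrightarrow> typing [] c T"
  by (cases c) (auto elim!: typing_elims intro: typing.intros)

lemma map_const_id: "map_const (\<lambda>c. c) t = t"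
  by (induction t) auto

lemma map_const_constant: "is_const c \<Longrightarrow> map_const \<theta> c = \<theta> c"
  by (cases c) auto

text \<open>A term is related to a family of terms. The index l bounds the number of reduction steps
  of the left-hand term that are taken into account, and the filter F says which members of the
  family matter.\<close>
locale log_rel =
  fixes F :: "nat filter" and B :: "nat \<Rightarrow> tm \<Rightarrow> (nat \<Rightarrow> tm) \<Rightarrow> bool"
  assumes B_mono: "B l t t' \<Longrightarrow> l' \<le> l \<Longrightarrow> B l' t t'"
    and B_step_left: "step t s \<Longrightarrow> B l s t' \<Longrightarrow> B (Suc l) t t'"
    and B_steps_right: "\<forall>\<^sub>F w in F. step\<^sup>*\<^sup>* (t' w) (s' w) \<Longrightarrow> B l t s' \<Longrightarrow> B l t t'"
begin

text \<open>The clause for functions ranges over all smaller indices, which builds in downward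
  closure.\<close>

fun LR :: "nat \<Rightarrow> ty \<Rightarrow> tm \<Rightarrow> (nat \<Rightarrow> tm) \<Rightarrow> bool" where
  "LR l N t t' = B l t t'"
| "LR l (Arr T U) t t' = (\<forall>l' a a'. l' \<le> l \<longrightarrow> typed_pair T a a' \<longrightarrow> LR l' T a a' \<longrightarrow>
      LR l' U (App t a) (\<lambda>w. App (t' w) (a' w)))"

lemma LR_mono: "LR l T t t' \<Longrightarrow> l' \<le> l \<Longrightarrow> LR l' T t t'"
  by (cases T) (auto intro: B_mono)

lemma LR_App:
  "LR l (Arr T U) t t' \<Longrightarrow> typed_pair T a a' \<Longrightarrow> LR l T a a' \<Longrightarrow>
    LR l U (App t a) (\<lambda>w. App (t' w) (a' w))"
  by simp

text \<open>A reduction on the left gains one unit of index; this drives the inductions for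
  recursion.\<close>

lemma LR_step_left: "LR l T s t' \<Longrightarrow> step t s \<Longrightarrow> LR (Suc l) T t t'"
proof (induction T arbitrary: l t s t')
  case N
  then show ?case by (simp add: B_step_left)
next
  case (Arr T U)
  have "LR l' U (App t a) (\<lambda>w. App (t' w) (a' w))"
    if "l' \<le> Suc l" "typed_pair T a a'" "LR l' T a a'" for l' a a'
  proof -
    \<comment> \<open>As \<open>l' \<le> Suc l\<close>, the index \<open>l' - 1\<close> is at most
      \<open>l\<close>; adding one at the end gives at least \<open>l'\<close>, also for
      \<open>l' = 0\<close>.\<close>
    have "LR (l' - 1) T a a'" using that(3) by (rule LR_mono) simp
    then have "LR (l' - 1) U (App s a) (\<lambda>w. App (t' w) (a' w))"
      using Arr.prems(1) that by simp
    then have "LR (Suc (l' - 1)) U (App t a) (\<lambda>w. App (t' w) (a' w))"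
      using Arr.IH(2) Arr.prems(2) S_AppL by blast
    then show ?thesis by (rule LR_mono) simp
  qed
  then show ?case by simp
qed

lemma LR_steps_right:
  "LR l T t s' \<Longrightarrow> \<forall>\<^sub>F w in F. step\<^sup>*\<^sup>* (t' w) (s' w) \<Longrightarrow> LR l T t t'"
proof (induction T arbitrary: l t s' t')
  case N
  then show ?case by (auto intro: B_steps_right)
next
  case (Arr T U)
  have "LR l' U (App t a) (\<lambda>w. App (t' w) (a' w))"
    if "l' \<le> l" "typed_pair T a a'" "LR l' T a a'" for l' a a'
  proof (rule Arr.IH(2))
    show "LR l' U (App t a) (\<lambda>w. App (s' w) (a' w))"
      using Arr.prems(1) that by simp
    show "\<forall>\<^sub>F w in F. step\<^sup>*\<^sup>* (App (t' w) (a' w)) (App (s' w) (a' w))"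
      using Arr.prems(2) by (rule eventually_mono) (rule steps_AppL)
  qed
  then show ?case by simp
qed

definition env_rel :: "nat \<Rightarrow> ty list \<Rightarrow> tm list \<Rightarrow> (nat \<Rightarrow> tm) list \<Rightarrow> bool" where
  "env_rel l \<Gamma> \<sigma> \<sigma>' \<longleftrightarrow> length \<sigma> = length \<Gamma> \<and> length \<sigma>' = length \<Gamma> \<and>
    (\<forall>i < length \<Gamma>. typed_pair (\<Gamma> ! i) (\<sigma> ! i) (\<sigma>' ! i) \<and> LR l (\<Gamma> ! i) (\<sigma> ! i) (\<sigma>' ! i))"

text \<open>The lift to open terms by related closing environments. The right-hand environment is a
  list of families, evaluated at the same \<open>w\<close> as the term.\<close>

definition sem :: "ty list \<Rightarrow> tm \<Rightarrow> (nat \<Rightarrow> tm) \<Rightarrow> ty \<Rightarrow> bool" where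
  "sem \<Gamma> t t' T \<longleftrightarrow> typing \<Gamma> t T \<and> (\<forall>w. typing \<Gamma> (t' w) T) \<and>
    (\<forall>l \<sigma> \<sigma>'. env_rel l \<Gamma> \<sigma> \<sigma>' \<longrightarrow>
      LR l T (inst \<sigma> 0 t) (\<lambda>w. inst (map (\<lambda>s. s w) \<sigma>') 0 (t' w)))"

lemma env_rel_mono: "env_rel l \<Gamma> \<sigma> \<sigma>' \<Longrightarrow> l' \<le> l \<Longrightarrow> env_rel l' \<Gamma> \<sigma> \<sigma>'"
  by (auto simp: env_rel_def intro: LR_mono)

lemma env_rel_Cons:
  "env_rel l \<Gamma> \<sigma> \<sigma>' \<Longrightarrow> typed_pair T a a' \<Longrightarrow> LR l T a a' \<Longrightarrow> env_rel l (T # \<Gamma>) (a # \<sigma>) (a' # \<sigma>')"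
  by (auto simp: env_rel_def nth_Cons split: nat.split)

lemma env_rel_typing:
  assumes "env_rel l \<Gamma> \<sigma> \<sigma>'" and "i < length \<Gamma>"
  shows "typing [] (\<sigma> ! i) (\<Gamma> ! i)" and "typing [] (map (\<lambda>s. s w) \<sigma>' ! i) (\<Gamma> ! i)"
  using assms by (auto simp: env_rel_def typed_pair_def)

lemma sem_closedD:
  assumes "sem [] t t' T"
  shows "typed_pair T t t'" and "LR l T t t'"
proof -
  show "typed_pair T t t'" using assms by (simp add: sem_def typed_pair_def)
  have "env_rel l [] [] []" by (simp add: env_rel_def)
  then have "LR l T (inst [] 0 t) (\<lambda>w. inst (map (\<lambda>s. s w) []) 0 (t' w))"
    using assms unfolding sem_def by blast
  moreover have "inst [] 0 t = t" "\<And>w. inst [] 0 (t' w) = t' w"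
    using assms by (auto simp: sem_def intro: inst_closed)
  ultimately show "LR l T t t'" by simp
qed

lemma sem_closedI:
  assumes "typed_pair T t t'" and "\<And>l. LR l T t t'"
  shows "sem \<Gamma> t t' T"
proof -
  have "inst \<sigma> 0 t = t" "inst \<sigma> 0 (t' w) = t' w" for \<sigma> w
    using assms(1) by (auto simp: typed_pair_def intro: inst_closed)
  then show ?thesis
    using assms by (auto simp: sem_def typed_pair_def intro: typing_closed)
qed

lemma sem_Var: "i < length \<Gamma> \<Longrightarrow> sem \<Gamma> (Var i) (\<lambda>w. Var i) (\<Gamma> ! i)"
  by (auto simp: sem_def env_rel_def intro: T_Var)

lemma sem_App:
  assumes "sem \<Gamma> t t' (Arr T U)" and "sem \<Gamma> a a' T"
  shows "sem \<Gamma> (App t a) (\<lambda>w. App (t' w) (a' w)) U"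
proof -
  have "LR l U (inst \<sigma> 0 (App t a)) (\<lambda>w. inst (map (\<lambda>s. s w) \<sigma>') 0 (App (t' w) (a' w)))"
    if env: "env_rel l \<Gamma> \<sigma> \<sigma>'" for l \<sigma> \<sigma>'
  proof -
    have "typed_pair T (inst \<sigma> 0 a) (\<lambda>w. inst (map (\<lambda>s. s w) \<sigma>') 0 (a' w))"
      using assms(2) typing_inst[of "[]" \<Gamma>] env_rel_typing[OF env]
      by (simp add: typed_pair_def sem_def)
    moreover have "LR l (Arr T U) (inst \<sigma> 0 t) (\<lambda>w. inst (map (\<lambda>s. s w) \<sigma>') 0 (t' w))"
      "LR l T (inst \<sigma> 0 a) (\<lambda>w. inst (map (\<lambda>s. s w) \<sigma>') 0 (a' w))"
      using assms env unfolding sem_def by blast+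
    ultimately have "LR l U (App (inst \<sigma> 0 t) (inst \<sigma> 0 a))
        (\<lambda>w. App (inst (map (\<lambda>s. s w) \<sigma>') 0 (t' w)) (inst (map (\<lambda>s. s w) \<sigma>') 0 (a' w)))"
      by (intro LR_App[where T = T])
    then show ?thesis by simp
  qed
  moreover have "typing \<Gamma> (App t a) U" "typing \<Gamma> (App (t' w) (a' w)) U" for w
    using assms by (auto simp: sem_def intro: T_App[where T = T])
  ultimately show ?thesis by (simp add: sem_def)
qed

text \<open>Both applications beta-reduce to the bodies closed by the extended environments, so the
  two reduction lemmas carry the relation back.\<close>

lemma sem_Lam:
  assumes "sem (T # \<Gamma>) b b' U"
  shows "sem \<Gamma> (Lam T b) (\<lambda>w. Lam T (b' w)) (Arr T U)"
proof -
  have "LR l' U (App (inst \<sigma> 0 (Lam T b)) a)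
      (\<lambda>w. App (inst (map (\<lambda>s. s w) \<sigma>') 0 (Lam T (b' w))) (a' w))"
    if env: "env_rel l \<Gamma> \<sigma> \<sigma>'" and a: "l' \<le> l" "typed_pair T a a'" "LR l' T a a'" for l l' \<sigma> \<sigma>' a a'
  proof -
    have "env_rel l' (T # \<Gamma>) (a # \<sigma>) (a' # \<sigma>')"
      using env_rel_Cons env_rel_mono env a by blast
    then have "LR l' U (inst (a # \<sigma>) 0 b) (\<lambda>w. inst (map (\<lambda>s. s w) (a' # \<sigma>')) 0 (b' w))"
      using assms unfolding sem_def by blast
    moreover have "step (App (inst \<sigma> 0 (Lam T b)) a) (inst (a # \<sigma>) 0 b)"
      using subst_inst[of "[]" T \<Gamma> b U a \<sigma>] assms a(2) env_rel_typing[OF env]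
        S_Beta[of T "inst \<sigma> (Suc 0) b" a]
      by (simp add: sem_def typed_pair_def)
    moreover have "step (App (inst (map (\<lambda>s. s w) \<sigma>') 0 (Lam T (b' w))) (a' w))
        (inst (map (\<lambda>s. s w) (a' # \<sigma>')) 0 (b' w))" for w
      using subst_inst[of "[]" T \<Gamma> "b' w" U "a' w" "map (\<lambda>s. s w) \<sigma>'"] assms a(2)
        env_rel_typing[OF env] S_Beta[of T "inst (map (\<lambda>s. s w) \<sigma>') (Suc 0) (b' w)" "a' w"]
      by (simp add: sem_def typed_pair_def)
    ultimately have "LR (Suc l') U (App (inst \<sigma> 0 (Lam T b)) a)
        (\<lambda>w. App (inst (map (\<lambda>s. s w) \<sigma>') 0 (Lam T (b' w))) (a' w))"
      by (intro LR_steps_right[OF LR_step_left] always_eventually allI r_into_rtranclp)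
    then show ?thesis by (rule LR_mono) simp
  qed
  then show ?thesis using assms by (auto simp: sem_def intro: T_Lam)
qed

text \<open>The fundamental lemma: variables, abstraction and application preserve relatedness, so
  only the replacement of constants remains to be checked in each instance.\<close>

lemma sem_map_const:
  assumes "\<And>c T. is_const c \<Longrightarrow> typing [] c T \<Longrightarrow> sem [] c (\<lambda>w. \<theta> w c) T"
  shows "typing \<Gamma> t T \<Longrightarrow> sem \<Gamma> t (\<lambda>w. map_const (\<theta> w) t) T"
proof -
  have const: "sem \<Gamma> c (\<lambda>w. map_const (\<theta> w) c) T" if "is_const c" "typing [] c T" for \<Gamma> c T
    using sem_closedI[OF sem_closedD[OF assms[OF that]]] that(1) by (simp add: map_const_constant)
  show "typing \<Gamma> t T \<Longrightarrow> sem \<Gamma> t (\<lambda>w. map_const (\<theta> w) t) T"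
  proof (induction t arbitrary: \<Gamma> T)
    case (Var i)
    then show ?case by (auto elim: typing_VarE intro: sem_Var)
  next
    case (Lam S t)
    then show ?case by (auto elim!: typing_LamE intro: sem_Lam)
  next
    case (App t1 t2)
    from App.prems obtain S where "typing \<Gamma> t1 (Arr S T)" "typing \<Gamma> t2 S"
      by (rule typing_AppE)
    then show ?case using App.IH by (auto intro: sem_App[where T = S])
  qed (rule const, simp, erule typing_is_const[rotated], simp)+
qed

end

section \<open>The translation into total terms\<close>

section \<open>Bottom as an exceptional numeral\<close>

text \<open>The substitute for the bottom element at each type, from which recursion is
  unrolled.\<close>

fun const_fun :: "nat \<Rightarrow> ty \<Rightarrow> tm" where
  "const_fun d N = Num d"
| "const_fun d (Arr T U) = Lam T (const_fun d U)"

definition strict_ext :: "nat \<Rightarrow> (nat \<Rightarrow> nat option) \<Rightarrow> nat \<Rightarrow> nat option" where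
  "strict_ext d f n = Some (if n = d then d else case f n of None \<Rightarrow> d | Some m \<Rightarrow> m)"

text \<open>Variables 2, 1 and 0 are the condition and the two branches. The outer test propagates
  \<open>d\<close>, as \<open>eq_test d\<close> yields 0 exactly on \<open>d\<close>.\<close>

definition exc_Ifz :: "nat \<Rightarrow> tm" where
  "exc_Ifz d = Lam N (Lam N (Lam N
    (App (App (App Ifz (App (eq_test d) (Var 2))) (Num d))
      (App (App (App Ifz (Var 2)) (Var 1)) (Var 0)))))"

text \<open>The number of unrollings grows with \<open>d\<close>, so a computation of finitely many
  steps cannot tell this from the fixed point once \<open>d\<close> is large.\<close>

definition exc_Fix :: "nat \<Rightarrow> ty \<Rightarrow> tm" where
  "exc_Fix d T = Lam (Arr T T) ((App (Var 0) ^^ d) (const_fun d T))"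

text \<open>The numeral d plays the role of divergence.\<close>
fun exc_const :: "nat \<Rightarrow> tm \<Rightarrow> tm" where
  "exc_const d Succ = Cst (strict_ext d (\<lambda>n. Some (Suc n)))"
| "exc_const d Pred = Cst (strict_ext d (\<lambda>n. Some (n - 1)))"
| "exc_const d (Cst f) = Cst (strict_ext d f)"
| "exc_const d Ifz = exc_Ifz d"
| "exc_const d (Fix T) = exc_Fix d T"
| "exc_const d t = t"

lemma typing_const_fun: "typing \<Gamma> (const_fun d T) T"
  by (induction T arbitrary: \<Gamma>) (auto intro: typing.intros)

lemma typing_exc_Ifz: "typing [] (exc_Ifz d) (Arr N (Arr N (Arr N N)))"
proof -
  let ?\<Gamma> = "[N, N, N]"
  have "typing ?\<Gamma> (Var 0) N" "typing ?\<Gamma> (Var 1) N" "typing ?\<Gamma> (Var 2) N"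
    by (auto intro: T_Var)
  moreover have "typing ?\<Gamma> (App (App (App Ifz s) a) b) N"
    if "typing ?\<Gamma> s N" "typing ?\<Gamma> a N" "typing ?\<Gamma> b N" for s a b
    using that T_App T_Ifz by blast
  moreover have "typing ?\<Gamma> (App (eq_test d) s) N" if "typing ?\<Gamma> s N" for s
    using that T_App T_Cst unfolding eq_test_def by blast
  ultimately show ?thesis
    unfolding exc_Ifz_def by (intro T_Lam) (simp add: T_Num)
qed

lemma typing_iterate:
  assumes "typing \<Gamma> t (Arr T T)" and "typing \<Gamma> u T"
  shows "typing \<Gamma> ((App t ^^ i) u) T"
  using assms(2) by (induction i) (auto intro: T_App[OF assms(1)])

lemma typing_exc_Fix: "typing [] (exc_Fix d T) (Arr (Arr T T) T)"
  unfolding exc_Fix_def by (intro T_Lam typing_iterate typing_const_fun) (auto intro: T_Var)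

lemma typing_exc_const: "is_const c \<Longrightarrow> typing [] c T \<Longrightarrow> typing [] (exc_const d c) T"
  by (cases c) (auto elim!: typing_elims intro: typing.intros typing_exc_Ifz typing_exc_Fix)

lemma steps_exc_Ifz:
  assumes "typing [] s N" and "typing [] a N" and "typing [] b N"
  shows "step\<^sup>*\<^sup>* (App (App (App (exc_Ifz d) s) a) b)
    (App (App (App Ifz (App (eq_test d) s)) (Num d)) (App (App (App Ifz s) a) b))"
proof -
  let ?body = "\<lambda>x y z. App (App (App Ifz (App (eq_test d) x)) (Num d)) (App (App (App Ifz x) y) z)"
  have "step (App (exc_Ifz d) s) (Lam N (Lam N (?body s (Var 1) (Var 0))))"
    using S_Beta[of N "Lam N (Lam N (?body (Var 2) (Var 1) (Var 0)))" s] assms(1)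
    by (simp add: exc_Ifz_def eq_test_def lift_closed)
  then have 1: "step (App (App (App (exc_Ifz d) s) a) b)
      (App (App (Lam N (Lam N (?body s (Var 1) (Var 0)))) a) b)"
    by (intro S_AppL)
  have "step (App (Lam N (Lam N (?body s (Var 1) (Var 0)))) a) (Lam N (?body s a (Var 0)))"
    using S_Beta[of N "Lam N (?body s (Var 1) (Var 0))" a] assms
    by (simp add: eq_test_def lift_closed subst_closed)
  then have 2: "step (App (App (Lam N (Lam N (?body s (Var 1) (Var 0)))) a) b)
      (App (Lam N (?body s a (Var 0))) b)"
    by (intro S_AppL)
  have "step (App (Lam N (?body s a (Var 0))) b) (?body s a b)"
    using S_Beta[of N "?body s a (Var 0)" b] assms
    by (simp add: eq_test_def subst_closed)
  with 1 2 show ?thesis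
    by (meson converse_rtranclp_into_rtranclp r_into_rtranclp)
qed

lemma step_exc_Fix:
  assumes "typing [] a T"
  shows "step (App (exc_Fix d U) a) ((App a ^^ d) (const_fun d U))"
proof -
  have "subst ((App (Var 0) ^^ i) t) a 0 = (App a ^^ i) (subst t a 0)" for i t
    by (induction i) auto
  moreover have "subst (const_fun d U) a 0 = const_fun d U"
    using typing_const_fun by (rule subst_closed)
  ultimately show ?thesis
    using S_Beta[of "Arr U U" "(App (Var 0) ^^ d) (const_fun d U)" a] by (simp add: exc_Fix_def)
qed

lemma evals_eq_test: "evals s n \<Longrightarrow> evals (App (eq_test i) s) (if n = i then 0 else 1)"
  unfolding eq_test_def by (rule evals_prim[OF prim.intros(3)]) auto

section \<open>First instance: convergence survives the translation for all large
  \<open>d\<close>\<close>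

section \<open>Approximation: eventual agreement\<close>

text \<open>The index counts steps on the left only; how large \<open>w\<close> must be may depend
  on the terms and on \<open>n\<close>.\<close>

definition agree_ev :: "nat \<Rightarrow> tm \<Rightarrow> (nat \<Rightarrow> tm) \<Rightarrow> bool" where
  "agree_ev l t t' \<longleftrightarrow>
    (\<forall>i\<le>l. \<forall>n. (step ^^ i) t (Num n) \<longrightarrow> (\<forall>\<^sub>F w in at_top. evals (t' w) n))"

interpretation ev: log_rel at_top agree_ev
proof
  fix t s t' s' l l'
  show "agree_ev l t t' \<Longrightarrow> l' \<le> l \<Longrightarrow> agree_ev l' t t'"
    unfolding agree_ev_def by (meson order_trans)
  show "agree_ev (Suc l) t t'" if "step t s" "agree_ev l s t'"
    unfolding agree_ev_def
  proof (intro allI impI)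
    fix i n
    assume "i \<le> Suc l" "(step ^^ i) t (Num n)"
    \<comment> \<open>A term that can step is no numeral, so the number of steps is
      positive.\<close>
    moreover from this that(1) obtain j where j: "i = Suc j"
      by (cases i) auto
    ultimately obtain u where "step t u" "(step ^^ j) u (Num n)" "j \<le> l"
      by (metis Suc_le_mono relpowp_Suc_E2)
    then show "\<forall>\<^sub>F w in at_top. evals (t' w) n"
      using that step_deterministic unfolding agree_ev_def by blast
  qed
  show "agree_ev l t t'" if "\<forall>\<^sub>F w in at_top. step\<^sup>*\<^sup>* (t' w) (s' w)" "agree_ev l t s'"
    unfolding agree_ev_def
  proof (intro allI impI)
    fix i n
    assume "i \<le> l" "(step ^^ i) t (Num n)"
    then have "\<forall>\<^sub>F w in at_top. evals (s' w) n"
      using that(2) by (simp add: agree_ev_def)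
    with that(1) show "\<forall>\<^sub>F w in at_top. evals (t' w) n"
      by eventually_elim (rule evals_steps)
  qed
qed

lemma agree_evI: "(\<And>n. evals t n \<Longrightarrow> \<forall>\<^sub>F w in at_top. evals (t' w) n) \<Longrightarrow> agree_ev l t t'"
  by (auto simp: agree_ev_def dest: evals_relpowp)

lemma agree_ev_Num: "agree_ev l (Num n) (\<lambda>w. Num n)"
  using evals_unique[OF evals_Num] by (auto intro!: agree_evI simp: evals_Num)

lemma agree_evD:
  assumes "\<And>l. agree_ev l t t'" and "evals t n"
  shows "\<forall>\<^sub>F w in at_top. evals (t' w) n"
  using assms unfolding agree_ev_def evals_def by (meson order_refl rtranclp_imp_relpowp)

lemma agree_ev_0_App: "agree_ev 0 (App t a) t'"
  by (simp add: agree_ev_def)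

text \<open>An application is no numeral, so index 0 demands nothing of it, and further arguments
  leave it an application. This starts the inductions for \<open>Fix\<close>.\<close>

lemma ev_LR_0_App: "ev.LR 0 T (App t a) t'"
  by (induction T arbitrary: t a t') (auto simp: agree_ev_0_App)

lemma ev_LR_prim:
  assumes "prim c \<phi>" and "\<And>w. prim (c' w) (\<phi>' w)"
    and "\<And>n m. \<phi> n = Some m \<Longrightarrow> \<forall>\<^sub>F w in at_top. \<phi>' w n = Some m"
  shows "ev.LR l (Arr N N) c c'"
proof -
  have "agree_ev l' (App c s) (\<lambda>w. App (c' w) (s' w))" if s: "agree_ev l' s s'" for l' s s'
    unfolding agree_ev_def
  proof (intro allI impI)
    fix i m
    assume "i \<le> l'" "(step ^^ i) (App c s) (Num m)"
    then obtain n j where "j \<le> l'" "(step ^^ j) s (Num n)" "\<phi> n = Some m"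
      using relpowp_step_prim[OF assms(1)] by (meson order_trans)
    then have "\<forall>\<^sub>F w in at_top. evals (s' w) n" "\<forall>\<^sub>F w in at_top. \<phi>' w n = Some m"
      using s assms(3) unfolding agree_ev_def by blast+
    then show "\<forall>\<^sub>F w in at_top. evals (App (c' w) (s' w)) m"
      by eventually_elim (rule evals_prim[OF assms(2)])
  qed
  then show ?thesis by simp
qed

text \<open>The family \<open>c\<close> has to behave like \<open>Ifz\<close> only when the
  condition differs from \<open>w\<close>, which covers both \<open>Ifz\<close> and
  \<open>exc_Ifz\<close>: a fixed value of the condition differs from all large
  \<open>w\<close>.\<close>

lemma ev_LR_Ifz:
  assumes "\<And>w s a b n m. typing [] s N \<Longrightarrow> typing [] a N \<Longrightarrow> typing [] b N \<Longrightarrow>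
      n \<noteq> w \<Longrightarrow> evals s n \<Longrightarrow> evals (if n = 0 then a else b) m \<Longrightarrow> evals (App (App (App (c w) s) a) b) m"
  shows "ev.LR l (Arr N (Arr N (Arr N N))) Ifz c"
proof -
  have "agree_ev l' (App (App (App Ifz s) a) b) (\<lambda>w. App (App (App (c w) (s' w)) (a' w)) (b' w))"
    if ty: "typed_pair N s s'" "typed_pair N a a'" "typed_pair N b b'"
      and le: "l' \<le> l2" "l2 \<le> l1"
      and "agree_ev l1 s s'" "agree_ev l2 a a'" "agree_ev l' b b'" for l' l1 l2 s s' a a' b b'
    unfolding agree_ev_def
  proof (intro allI impI)
    have rel: "agree_ev l' s s'" "agree_ev l' a a'" "agree_ev l' b b'"
      using that ev.B_mono order_trans by blast+
    fix i m
    assume "i \<le> l'" "(step ^^ i) (App (App (App Ifz s) a) b) (Num m)"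
    then obtain n j j' where *: "j \<le> l'" "j' \<le> l'" "(step ^^ j) s (Num n)"
      "(step ^^ j') (if n = 0 then a else b) (Num m)"
      using relpowp_step_Ifz by (meson order_trans)
    then have "\<forall>\<^sub>F w in at_top. evals (s' w) n"
      using rel(1) by (auto simp: agree_ev_def)
    moreover have "\<forall>\<^sub>F w in at_top. evals (if n = 0 then a' w else b' w) m"
      using rel(2,3) * by (auto simp: agree_ev_def split: if_splits)
    moreover have "\<forall>\<^sub>F w in at_top. n \<noteq> w"
      using eventually_gt_at_top[of n] by eventually_elim simp
    ultimately show "\<forall>\<^sub>F w in at_top. evals (App (App (App (c w) (s' w)) (a' w)) (b' w)) m"
      by eventually_elim (use ty in \<open>auto simp: typed_pair_def intro: assms\<close>)
  qed
  then show ?thesis by auto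
qed

text \<open>Each unfolding on the left costs one step, so the recursive occurrence is needed at a
  smaller index only.\<close>

lemma ev_LR_Fix: "ev.LR l (Arr (Arr T T) T) (Fix T) (\<lambda>w. Fix T)"
proof -
  have "ev.LR l T (App (Fix T) a) (\<lambda>w. App (Fix T) (a' w))"
    if ty: "typed_pair (Arr T T) a a'" and "ev.LR l (Arr T T) a a'" for l a a'
    using that(2)
  proof (induction l)
    case 0
    show ?case by (rule ev_LR_0_App)
  next
    case (Suc l)
    have rel: "ev.LR l (Arr T T) a a'" using Suc.prems by (rule ev.LR_mono) simp
    have "typed_pair T (App (Fix T) a) (\<lambda>w. App (Fix T) (a' w))"
      using ty by (auto simp: typed_pair_def intro: T_App T_Fix)
    then have "ev.LR l T (App a (App (Fix T) a)) (\<lambda>w. App (a' w) (App (Fix T) (a' w)))"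
      by (rule ev.LR_App[OF rel _ Suc.IH[OF rel]])
    then have "ev.LR (Suc l) T (App (Fix T) a) (\<lambda>w. App (a' w) (App (Fix T) (a' w)))"
      by (rule ev.LR_step_left) (rule S_Fix)
    then show ?case
      by (rule ev.LR_steps_right) (intro always_eventually allI r_into_rtranclp S_Fix)
  qed
  then show ?thesis by simp
qed

text \<open>Within \<open>l\<close> steps at most \<open>l\<close> unfoldings are visible on the
  left, and \<open>d\<close> eventually exceeds \<open>l\<close>.\<close>

lemma ev_LR_exc_Fix: "ev.LR l (Arr (Arr T T) T) (Fix T) (\<lambda>d. exc_Fix d T)"
proof -
  \<comment> \<open>The number of iterations is generalized from \<open>d\<close> to any
    \<open>g d\<close> that is eventually at least \<open>l\<close>, because the induction step
    passes to \<open>g d - 1\<close>.\<close>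
  have iter: "ev.LR l T (App (Fix T) a) (\<lambda>d. (App (a' d) ^^ g d) (const_fun d T))"
    if ty: "typed_pair (Arr T T) a a'" and "ev.LR l (Arr T T) a a'" and "\<forall>\<^sub>F d in at_top. l \<le> g d"
    for l a a' g
    using that(2,3)
  proof (induction l arbitrary: g)
    case 0
    show ?case by (rule ev_LR_0_App)
  next
    case (Suc l)
    have rel: "ev.LR l (Arr T T) a a'" using Suc.prems(1) by (rule ev.LR_mono) simp
    have "\<forall>\<^sub>F d in at_top. l \<le> g d - 1"
      using Suc.prems(2) by eventually_elim simp
    note IH = Suc.IH[OF rel this]
    have "typed_pair T (App (Fix T) a) (\<lambda>d. (App (a' d) ^^ (g d - 1)) (const_fun d T))"
      using ty by (auto simp: typed_pair_def intro: T_App T_Fix typing_iterate typing_const_fun)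
    then have "ev.LR l T (App a (App (Fix T) a))
        (\<lambda>d. App (a' d) ((App (a' d) ^^ (g d - 1)) (const_fun d T)))"
      by (rule ev.LR_App[OF rel _ IH])
    then have "ev.LR (Suc l) T (App (Fix T) a)
        (\<lambda>d. App (a' d) ((App (a' d) ^^ (g d - 1)) (const_fun d T)))"
      by (rule ev.LR_step_left) (rule S_Fix)
    moreover have "\<forall>\<^sub>F d in at_top. step\<^sup>*\<^sup>* ((App (a' d) ^^ g d) (const_fun d T))
        (App (a' d) ((App (a' d) ^^ (g d - 1)) (const_fun d T)))"
      using Suc.prems(2)
    proof eventually_elim
      case (elim d)
      then obtain m where "g d = Suc m" by (cases "g d") auto
      then show ?case by simp
    qed
    ultimately show ?case by (rule ev.LR_steps_right)
  qed
  have "ev.LR l T (App (Fix T) a) (\<lambda>d. App (exc_Fix d T) (a' d))"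
    if "typed_pair (Arr T T) a a'" "ev.LR l (Arr T T) a a'" for l a a'
  proof (rule ev.LR_steps_right)
    show "ev.LR l T (App (Fix T) a) (\<lambda>d. (App (a' d) ^^ d) (const_fun d T))"
      using iter[OF that, of "\<lambda>d. d"] eventually_ge_at_top by blast
    show "\<forall>\<^sub>F d in at_top. step\<^sup>*\<^sup>* (App (exc_Fix d T) (a' d)) ((App (a' d) ^^ d) (const_fun d T))"
      using that(1) by (auto simp: typed_pair_def intro!: always_eventually r_into_rtranclp step_exc_Fix)
  qed
  then show ?thesis by simp
qed

text \<open>The fundamental lemma with all constants kept gives reflexivity, from which
  extensionality is drawn later.\<close>

lemma ev_sem_refl:
  assumes "typing \<Gamma> t T"
  shows "ev.sem \<Gamma> t (\<lambda>w. t) T"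
proof -
  have "ev.LR l T c (\<lambda>w. c)" if "is_const c" "typing [] c T" for l c T
  proof (cases c)
    case (Num n)
    then show ?thesis using that(2) by (auto elim!: typing_NumE intro: agree_ev_Num)
  next
    case Ifz
    have "ev.LR l (Arr N (Arr N (Arr N N))) Ifz (\<lambda>w. Ifz)"
      by (rule ev_LR_Ifz) (rule evals_Ifz)
    then show ?thesis using Ifz that(2) by (auto elim!: typing_IfzE)
  next
    case (Fix S)
    then show ?thesis using that(2) ev_LR_Fix by (auto elim!: typing_FixE simp del: ev.LR.simps)
  qed (use that in \<open>auto elim!: typing_elims intro!: ev_LR_prim prim.intros simp del: ev.LR.simps\<close>)
  then have "ev.sem \<Gamma> t (\<lambda>w. map_const (\<lambda>c. c) t) T"
    using assms by (intro ev.sem_map_const ev.sem_closedI) (auto simp: typed_pair_def)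
  then show ?thesis by (simp add: map_const_id)
qed

text \<open>Where \<open>f\<close> is defined, the extension can deviate only at
  \<open>d = n\<close>, so every \<open>d\<close> beyond \<open>n\<close> will do.\<close>

lemma eventually_strict_ext: "f n = Some m \<Longrightarrow> \<forall>\<^sub>F d in at_top. strict_ext d f n = Some m"
  using eventually_gt_at_top[of n] by eventually_elim (simp add: strict_ext_def)

lemma ev_sem_exc:
  assumes "typing \<Gamma> t T"
  shows "ev.sem \<Gamma> t (\<lambda>d. map_const (exc_const d) t) T"
proof -
  have prim: "ev.LR l (Arr N N) c (\<lambda>d. Cst (strict_ext d \<phi>))" if "prim c \<phi>" for l c \<phi>
    using that by (rule ev_LR_prim) (auto intro: prim.intros eventually_strict_ext)
  have "ev.LR l T c (\<lambda>d. exc_const d c)" if "is_const c" "typing [] c T" for l c T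
  proof (cases c)
    case (Num n)
    then show ?thesis using that(2) by (auto elim!: typing_NumE intro: agree_ev_Num)
  next
    case Ifz
    have "evals (App (App (App (exc_Ifz d) s) a) b) m"
      if "typing [] s N" "typing [] a N" "typing [] b N" "n \<noteq> d" "evals s n"
        "evals (if n = 0 then a else b) m" for d s a b n m
    proof (rule evals_steps[OF steps_exc_Ifz[OF that(1-3)]])
      show "evals (App (App (App Ifz (App (eq_test d) s)) (Num d)) (App (App (App Ifz s) a) b)) m"
        using evals_Ifz[OF evals_eq_test[OF that(5)]] evals_Ifz[OF that(5,6)] that(4) by simp
    qed
    then have "ev.LR l (Arr N (Arr N (Arr N N))) Ifz exc_Ifz"
      by (rule ev_LR_Ifz)
    then show ?thesis using Ifz that(2) by (auto elim!: typing_IfzE)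
  next
    case (Fix S)
    then show ?thesis using that(2) ev_LR_exc_Fix by (auto elim!: typing_FixE simp del: ev.LR.simps)
  qed (use that in \<open>auto elim!: typing_elims intro!: prim prim.intros simp del: ev.LR.simps One_nat_def\<close>)
  then show ?thesis
    using assms typing_exc_const
    by (intro ev.sem_map_const ev.sem_closedI) (auto simp: typed_pair_def)
qed

section \<open>Second instance: divergence becomes the answer \<open>d\<close>\<close>

section \<open>Divergence is turned into the exceptional numeral\<close>

text \<open>Convergence on the right is part of the relation, and \<open>d\<close> is the only
  answer that the left need not confirm; if the left diverges, the answer is therefore
  \<open>d\<close>. The filter below singles out the member with index \<open>d\<close>.\<close>

definition agree_exc :: "nat \<Rightarrow> nat \<Rightarrow> tm \<Rightarrow> (nat \<Rightarrow> tm) \<Rightarrow> bool" where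
  "agree_exc d l t t' \<longleftrightarrow> (\<exists>n. evals (t' d) n \<and> (n = d \<or> evals t n))"

interpretation exc: log_rel "principal {d}" "agree_exc d" for d
proof
  fix t s t' s' l l'
  show "agree_exc d l t t' \<Longrightarrow> l' \<le> l \<Longrightarrow> agree_exc d l' t t'"
    by (auto simp: agree_exc_def)
  show "step t s \<Longrightarrow> agree_exc d l s t' \<Longrightarrow> agree_exc d (Suc l) t t'"
    by (auto simp: agree_exc_def intro: evals_step)
  show "\<forall>\<^sub>F w in principal {d}. step\<^sup>*\<^sup>* (t' w) (s' w) \<Longrightarrow> agree_exc d l t s' \<Longrightarrow> agree_exc d l t t'"
    by (auto simp: agree_exc_def eventually_principal intro: evals_steps)
qed

lemma agree_excE:
  assumes "agree_exc d l t t'"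
  obtains "evals (t' d) d" | n where "n \<noteq> d" and "evals (t' d) n" and "evals t n"
  using assms unfolding agree_exc_def by metis

lemma agree_exc_Num: "agree_exc d l (Num n) (\<lambda>w. Num n)"
  by (auto simp: agree_exc_def intro: evals_Num)

text \<open>The answer \<open>d\<close> is always permitted, so this family is related to every
  left-hand term.\<close>

lemma exc_LR_const_fun: "exc.LR d l T t (\<lambda>w. const_fun w T)"
proof (induction T arbitrary: l t)
  case N
  have "agree_exc d l t Num" by (auto simp: agree_exc_def intro: evals_Num)
  then show ?case by simp
next
  case (Arr T U)
  have "exc.LR d l' U (App t a) (\<lambda>w. App (const_fun w (Arr T U)) (a' w))" for l' a a'
  proof (rule exc.LR_steps_right[OF Arr.IH(2)])
    have "step (App (const_fun w (Arr T U)) (a' w)) (const_fun w U)" for w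
      using S_Beta[of T "const_fun w U" "a' w"] subst_closed[OF typing_const_fun] by simp
    then show "\<forall>\<^sub>F w in principal {d}. step\<^sup>*\<^sup>* (App (const_fun w (Arr T U)) (a' w)) (const_fun w U)"
      by (intro always_eventually allI r_into_rtranclp)
  qed
  then show ?case by simp
qed

lemma exc_LR_prim:
  assumes "prim c \<phi>"
  shows "exc.LR d l (Arr N N) c (\<lambda>w. Cst (strict_ext w \<phi>))"
proof -
  have "agree_exc d l' (App c s) (\<lambda>w. App (Cst (strict_ext w \<phi>)) (s' w))"
    if "agree_exc d l' s s'" for l' s s'
    using that
  proof (cases rule: agree_excE)
    case 1
    then have "evals (App (Cst (strict_ext d \<phi>)) (s' d)) d"
      using evals_prim[OF prim.intros(3)] by (simp add: strict_ext_def)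
    then show ?thesis by (auto simp: agree_exc_def)
  next
    case (2 n)
    then have "evals (App (Cst (strict_ext d \<phi>)) (s' d)) (case \<phi> n of None \<Rightarrow> d | Some m \<Rightarrow> m)"
      using evals_prim[OF prim.intros(3)] by (simp add: strict_ext_def)
    moreover have "evals (App c s) m" if "\<phi> n = Some m" for m
      using assms 2(3) that by (rule evals_prim)
    ultimately show ?thesis by (cases "\<phi> n") (auto simp: agree_exc_def)
  qed
  then show ?thesis by simp
qed

lemma exc_LR_Ifz: "exc.LR d l (Arr N (Arr N (Arr N N))) Ifz exc_Ifz"
proof -
  have "agree_exc d l' (App (App (App Ifz s) a) b) (\<lambda>w. App (App (App (exc_Ifz w) (s' w)) (a' w)) (b' w))"
    if ty: "typed_pair N s s'" "typed_pair N a a'" "typed_pair N b b'"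
      and rel: "agree_exc d l1 s s'" "agree_exc d l2 a a'" "agree_exc d l3 b b'"
    for l' l1 l2 l3 s s' a a' b b'
  proof -
    let ?t = "App (App (App Ifz (App (eq_test d) (s' d))) (Num d)) (App (App (App Ifz (s' d)) (a' d)) (b' d))"
    have steps: "step\<^sup>*\<^sup>* (App (App (App (exc_Ifz d) (s' d)) (a' d)) (b' d)) ?t"
      using ty by (intro steps_exc_Ifz) (auto simp: typed_pair_def)
    have "\<exists>n. evals ?t n \<and> (n = d \<or> evals (App (App (App Ifz s) a) b) n)"
      using rel(1)
    proof (cases rule: agree_excE)
      case 1
      then have "evals ?t d"
        using evals_Ifz[OF evals_eq_test[OF 1, of d]] by (simp add: evals_Num)
      then show ?thesis by blast
    next
      case (2 n)
      obtain m where m: "evals (if n = 0 then a' d else b' d) m" "m = d \<or> evals (if n = 0 then a else b) m"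
        using rel(2,3) unfolding agree_exc_def by (cases "n = 0") auto
      have "evals ?t m"
        using evals_Ifz[OF evals_eq_test[OF 2(2), of d]] evals_Ifz[OF 2(2) m(1)] 2(1) by simp
      moreover have "m = d \<or> evals (App (App (App Ifz s) a) b) m"
        using m(2) evals_Ifz[OF 2(3)] by blast
      ultimately show ?thesis by blast
    qed
    then show ?thesis using evals_steps[OF steps] unfolding agree_exc_def by blast
  qed
  then show ?thesis by auto
qed

text \<open>Any number of iterations is sound: the seed is related to everything, hence to
  \<open>App (Fix T) a\<close>, and each further application of \<open>a'\<close> is matched by one
  unfolding on the left.\<close>

lemma exc_LR_Fix: "exc.LR d l (Arr (Arr T T) T) (Fix T) (\<lambda>w. exc_Fix w T)"
proof -
  have iter: "exc.LR d l T (App (Fix T) a) (\<lambda>w. (App (a' w) ^^ i) (const_fun w T))"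
    if ty: "typed_pair (Arr T T) a a'" and rel: "exc.LR d l (Arr T T) a a'" for l a a' i
  proof (induction i)
    case 0
    then show ?case using exc_LR_const_fun by simp
  next
    case (Suc i)
    have "typed_pair T (App (Fix T) a) (\<lambda>w. (App (a' w) ^^ i) (const_fun w T))"
      using ty by (auto simp: typed_pair_def intro: T_App T_Fix typing_iterate typing_const_fun)
    then have "exc.LR d l T (App a (App (Fix T) a))
        (\<lambda>w. App (a' w) ((App (a' w) ^^ i) (const_fun w T)))"
      by (rule exc.LR_App[OF rel _ Suc.IH])
    then have "exc.LR d (Suc l) T (App (Fix T) a)
        (\<lambda>w. App (a' w) ((App (a' w) ^^ i) (const_fun w T)))"
      by (rule exc.LR_step_left) (rule S_Fix)
    then have "exc.LR d l T (App (Fix T) a)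
        (\<lambda>w. App (a' w) ((App (a' w) ^^ i) (const_fun w T)))"
      by (rule exc.LR_mono) simp
    then show ?case by simp
  qed
  have "exc.LR d l T (App (Fix T) a) (\<lambda>w. App (exc_Fix w T) (a' w))"
    if "typed_pair (Arr T T) a a'" "exc.LR d l (Arr T T) a a'" for l a a'
  proof (rule exc.LR_steps_right[OF iter[OF that]])
    show "\<forall>\<^sub>F w in principal {d}. step\<^sup>*\<^sup>* (App (exc_Fix w T) (a' w)) ((App (a' w) ^^ d) (const_fun w T))"
      using that(1)
      by (auto simp: typed_pair_def eventually_principal intro!: r_into_rtranclp step_exc_Fix)
  qed
  then show ?thesis by simp
qed

text \<open>For a divergent closed program of type \<open>N\<close> this forces the translation to
  return \<open>d\<close>.\<close>

lemma exc_sem_exc: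
  assumes "typing \<Gamma> t T"
  shows "exc.sem d \<Gamma> t (\<lambda>w. map_const (exc_const w) t) T"
proof -
  have "exc.LR d l T c (\<lambda>w. exc_const w c)" if "is_const c" "typing [] c T" for l c T
  proof (cases c)
    case (Num n)
    then show ?thesis using that(2) by (auto elim!: typing_NumE intro: agree_exc_Num)
  next
    case Ifz
    then show ?thesis using that(2) exc_LR_Ifz by (auto elim!: typing_IfzE simp del: exc.LR.simps)
  next
    case (Fix S)
    then show ?thesis using that(2) exc_LR_Fix by (auto elim!: typing_FixE simp del: exc.LR.simps)
  qed (use that in \<open>auto elim!: typing_elims intro!: exc_LR_prim prim.intros
        simp del: exc.LR.simps One_nat_def\<close>)
  then show ?thesis
    using assms typing_exc_const
    by (intro exc.sem_map_const exc.sem_closedI) (auto simp: typed_pair_def)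
qed


section \<open>Finite procedures with \<open>d\<close> at every divergent leaf\<close>

section \<open>Finite nested sequential procedures\<close>

text \<open>Makes the default of \<open>case_chain\<close> a parameter, to serve procedures and
  their exceptional versions alike.\<close>

fun chain :: "tm \<Rightarrow> tm \<Rightarrow> (nat \<times> tm) list \<Rightarrow> tm" where
  "chain r a [] = r"
| "chain r a ((i, e) # bs) = App (App (App Ifz (App (eq_test i) a)) e) (chain r a bs)"

lemma case_chain_eq: "case_chain a bs = chain bot_tm a bs"
  by (induction a bs rule: case_chain.induct) auto

text \<open>In contrast to \<open>exc_const\<close>, the conditionals and equality tests stay as
  they are, which keeps \<open>p\<close> below the result. A scrutinee with value \<open>d\<close>
  still yields \<open>d\<close> by falling through to the default, provided that \<open>d\<close> is
  no branch label.\<close>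

primrec nsp_exc :: "nat \<Rightarrow> nsp \<Rightarrow> tm" and exp_exc :: "nat \<Rightarrow> exp \<Rightarrow> tm" where
  "nsp_exc d (PLam Ts e) = lams Ts (exp_exc d e)"
| "exp_exc d EBot = Num d"
| "exp_exc d (ENum n) = Num n"
| "exp_exc d (ECase x qs bs) =
     chain (Num d) (foldl App (Var x) (map (nsp_exc d) qs)) (map (map_prod id (exp_exc d)) bs)"

lemma typing_bot_tm: "typing \<Gamma> bot_tm T \<longleftrightarrow> T = N"
  unfolding bot_tm_def by (auto elim!: typing_elims intro: typing.intros)

lemma not_evals_bot_tm: "\<not> evals bot_tm n"
proof
  assume "evals bot_tm n"
  then obtain s where "step bot_tm s"
    unfolding evals_def bot_tm_def by (auto elim: converse_rtranclpE)
  then show False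
    unfolding bot_tm_def by (auto elim!: step_prim_cases[OF prim.intros(3)])
qed

text \<open>An empty chain does not contain its scrutinee, whence the condition in the second
  conclusion.\<close>

lemma typing_chainE:
  assumes "typing \<Gamma> (chain r a bs) T" and "typing \<Gamma> r N"
  shows "T = N" and "bs \<noteq> [] \<Longrightarrow> typing \<Gamma> a N" and "\<And>i e. (i, e) \<in> set bs \<Longrightarrow> typing \<Gamma> e N"
proof -
  have "T = N \<and> (bs \<noteq> [] \<longrightarrow> typing \<Gamma> a N) \<and> (\<forall>(i, e) \<in> set bs. typing \<Gamma> e N)"
    using assms
  proof (induction r a bs arbitrary: T rule: chain.induct)
    case (1 r a)
    then show ?case by (auto dest: typing_unique)
  next
    case (2 r a i e bs)
    from 2(2) have "T = N" "typing \<Gamma> a N" "typing \<Gamma> e N" "typing \<Gamma> (chain r a bs) N"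
      by (auto simp: eq_test_def elim!: typing_AppE typing_IfzE typing_CstE)
    with 2(1,3) show ?case by auto
  qed
  then show "T = N" and "bs \<noteq> [] \<Longrightarrow> typing \<Gamma> a N" and "\<And>i e. (i, e) \<in> set bs \<Longrightarrow> typing \<Gamma> e N"
    by auto
qed

lemma inst_chain: "inst \<sigma> k (chain r a bs) = chain (inst \<sigma> k r) (inst \<sigma> k a) (map (map_prod id (inst \<sigma> k)) bs)"
  by (induction r a bs rule: chain.induct) (auto simp: eq_test_def)

lemma typing_chain:
  assumes "typing \<Gamma> r N" and "bs \<noteq> [] \<Longrightarrow> typing \<Gamma> a N" and "\<And>i e. (i, e) \<in> set bs \<Longrightarrow> typing \<Gamma> e N"
  shows "typing \<Gamma> (chain r a bs) N"
  using assms
proof (induction r a bs rule: chain.induct)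
  case (2 r a i e bs)
  have "typing \<Gamma> (App (eq_test i) a) N"
    using 2(3) T_App[OF T_Cst] by (simp add: eq_test_def)
  moreover have "typing \<Gamma> e N" using 2(4) by auto
  moreover have "typing \<Gamma> (chain r a bs) N"
    using 2 by auto
  ultimately show ?case
    using T_App[OF T_App[OF T_App[OF T_Ifz]]] by simp
qed simp

text \<open>Collects what scrutinees are compared with, not the numerals at leaves: \<open>d\<close>
  has to avoid these labels so that every equality test fails on it.\<close>

primrec nsp_labels :: "nsp \<Rightarrow> nat set" and exp_labels :: "exp \<Rightarrow> nat set" where
  "nsp_labels (PLam Ts e) = exp_labels e"
| "exp_labels EBot = {}"
| "exp_labels (ENum n) = {}"
| "exp_labels (ECase x qs bs) =
     \<Union> (set (map nsp_labels qs)) \<union> fst ` set bs \<union> \<Union> (snd ` set (map (map_prod id exp_labels) bs))"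

lemma finite_labels: "finite (nsp_labels p)" "finite (exp_labels e)"
  by (induction p and e) auto

context log_rel
begin

lemma sem_lams:
  assumes "\<And>\<Gamma> T. typing \<Gamma> t T \<Longrightarrow> sem \<Gamma> t t' T"
  shows "typing \<Gamma> (lams Ts t) T \<Longrightarrow> sem \<Gamma> (lams Ts t) (\<lambda>w. lams Ts (t' w)) T"
  by (induction Ts arbitrary: \<Gamma> T) (auto intro: assms elim!: typing_LamE intro!: sem_Lam)

lemma sem_foldl_App:
  assumes "\<And>q T. q \<in> set qs \<Longrightarrow> typing \<Gamma> (f q) T \<Longrightarrow> sem \<Gamma> (f q) (\<lambda>w. f' q) T"
  shows "typing \<Gamma> (foldl App (Var x) (map f qs)) T \<Longrightarrow>
    sem \<Gamma> (foldl App (Var x) (map f qs)) (\<lambda>w. foldl App (Var x) (map f' qs)) T"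
  using assms
proof (induction qs arbitrary: T rule: rev_induct)
  case Nil
  then show ?case by (auto elim: typing_VarE intro: sem_Var)
next
  case (snoc q qs)
  from snoc.prems(1) obtain S where
    "typing \<Gamma> (foldl App (Var x) (map f qs)) (Arr S T)" "typing \<Gamma> (f q) S"
    by (auto elim: typing_AppE)
  then have "sem \<Gamma> (foldl App (Var x) (map f qs)) (\<lambda>w. foldl App (Var x) (map f' qs)) (Arr S T)"
    "sem \<Gamma> (f q) (\<lambda>w. f' q) S"
    using snoc.IH snoc.prems(2) by auto
  then show ?case by (auto intro: sem_App)
qed

text \<open>The induction over procedures, shared by both relations. They differ in how a chain of
  branches is handled and in which labels are allowed, hence the assumption \<open>chain\<close> and
  the set \<open>L\<close>.\<close>

lemma sem_nsp:
  assumes bot: "\<And>l. B l bot_tm (\<lambda>w. Num d)"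
    and num: "\<And>l n. B l (Num n) (\<lambda>w. Num n)"
    and chain: "\<And>\<Gamma> a a' bs. sem \<Gamma> a (\<lambda>w. a') N \<Longrightarrow>
      (\<And>i e. (i, e) \<in> set bs \<Longrightarrow> i \<in> L \<and> sem \<Gamma> (exp_tm e) (\<lambda>w. exp_exc d e) N) \<Longrightarrow>
      sem \<Gamma> (chain bot_tm a (map (map_prod id exp_tm) bs))
        (\<lambda>w. chain (Num d) a' (map (map_prod id (exp_exc d)) bs)) N"
  shows "nsp_labels p \<subseteq> L \<Longrightarrow> typing \<Gamma> (nsp_tm p) T \<Longrightarrow> sem \<Gamma> (nsp_tm p) (\<lambda>w. nsp_exc d p) T"
    and "exp_labels e \<subseteq> L \<Longrightarrow> typing \<Gamma> (exp_tm e) T \<Longrightarrow> sem \<Gamma> (exp_tm e) (\<lambda>w. exp_exc d e) T"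
proof -
  have sem_bot: "sem \<Gamma> bot_tm (\<lambda>w. Num d) N" for \<Gamma>
    by (rule sem_closedI) (auto simp: typed_pair_def typing_bot_tm bot intro: T_Num)
  have "\<forall>\<Gamma> T. nsp_labels p \<subseteq> L \<longrightarrow> typing \<Gamma> (nsp_tm p) T \<longrightarrow> sem \<Gamma> (nsp_tm p) (\<lambda>w. nsp_exc d p) T"
    and "\<forall>\<Gamma> T. exp_labels e \<subseteq> L \<longrightarrow> typing \<Gamma> (exp_tm e) T \<longrightarrow> sem \<Gamma> (exp_tm e) (\<lambda>w. exp_exc d e) T"
  proof (induction p and e)
    case (PLam Ts e)
    then show ?case using sem_lams[of "exp_tm e" "\<lambda>w. exp_exc d e"] by auto
  next
    case EBot
    then show ?case by (auto simp: typing_bot_tm sem_bot)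
  next
    case (ENum n)
    have "sem \<Gamma> (Num n) (\<lambda>w. Num n) N" for \<Gamma>
      by (rule sem_closedI) (auto simp: typed_pair_def num intro: T_Num)
    then show ?case by (auto elim!: typing_NumE)
  next
    case (ECase x qs bs)
    show ?case
    proof (intro allI impI)
      fix \<Gamma> T
      assume L: "exp_labels (ECase x qs bs) \<subseteq> L" and ty: "typing \<Gamma> (exp_tm (ECase x qs bs)) T"
      let ?a = "foldl App (Var x) (map nsp_tm qs)" and ?a' = "foldl App (Var x) (map (nsp_exc d) qs)"
      let ?bs = "map (map_prod id exp_tm) bs" and ?bs' = "map (map_prod id (exp_exc d)) bs"
      note chainE = typing_chainE[OF ty[unfolded exp_tm.simps case_chain_eq]]
      have T: "T = N" using chainE by (simp add: typing_bot_tm)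
      show "sem \<Gamma> (exp_tm (ECase x qs bs)) (\<lambda>w. exp_exc d (ECase x qs bs)) T"
      proof (cases "bs = []")
        \<comment> \<open>The scrutinee may be ill-typed here, but it has vanished: both sides are
          just the defaults.\<close>
        case True
        then show ?thesis using T sem_bot by simp
      next
        case False
        then have "typing \<Gamma> ?a N" using chainE(2) by (simp add: typing_bot_tm)
        then have "sem \<Gamma> ?a (\<lambda>w. ?a') N"
          by (rule sem_foldl_App[rotated]) (use ECase.IH(1) L in fastforce)
        moreover have "i \<in> L \<and> sem \<Gamma> (exp_tm e) (\<lambda>w. exp_exc d e) N" if ie: "(i, e) \<in> set bs" for i e
        proof
          have "(i, exp_tm e) \<in> set ?bs" using ie by force
          then have "typing \<Gamma> (exp_tm e) N" using chainE(3) by (simp add: typing_bot_tm)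
          moreover have "exp_labels e \<subseteq> L" using L ie by force
          ultimately show "sem \<Gamma> (exp_tm e) (\<lambda>w. exp_exc d e) N"
            using ECase.IH(2)[OF ie, of e] by simp
          show "i \<in> L" using L ie by force
        qed
        ultimately have "sem \<Gamma> (chain bot_tm ?a ?bs) (\<lambda>w. chain (Num d) ?a' ?bs') N"
          by (rule chain)
        then show ?thesis using T by (simp add: case_chain_eq)
      qed
    qed
  qed
  then show "nsp_labels p \<subseteq> L \<Longrightarrow> typing \<Gamma> (nsp_tm p) T \<Longrightarrow> sem \<Gamma> (nsp_tm p) (\<lambda>w. nsp_exc d p) T"
    and "exp_labels e \<subseteq> L \<Longrightarrow> typing \<Gamma> (exp_tm e) T \<Longrightarrow> sem \<Gamma> (exp_tm e) (\<lambda>w. exp_exc d e) T"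
    by blast+
qed

end

text \<open>With \<open>d\<close> fixed the family is constant, so eventual agreement is plain
  agreement; this will place \<open>p\<close> below its exceptional version.\<close>

lemma ev_sem_nsp:
  assumes "typing \<Gamma> (nsp_tm p) T"
  shows "ev.sem \<Gamma> (nsp_tm p) (\<lambda>w. nsp_exc d p) T"
proof (rule ev.sem_nsp(1)[where L = UNIV, OF _ agree_ev_Num _ _ assms])
  show bot: "agree_ev l bot_tm (\<lambda>w. Num d)" for l
    by (rule agree_evI) (simp add: not_evals_bot_tm)
  fix \<Gamma> a a' and bs :: "(nat \<times> exp) list"
  assume a: "ev.sem \<Gamma> a (\<lambda>w. a') N"
    and bs: "\<And>i e. (i, e) \<in> set bs \<Longrightarrow> i \<in> UNIV \<and> ev.sem \<Gamma> (exp_tm e) (\<lambda>w. exp_exc d e) N"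
  \<comment> \<open>\<open>Ifz\<close> and the equality tests are related to themselves here, so a
    chain is handled by compatibility with application.\<close>
  have Ifz: "ev.sem \<Gamma> Ifz (\<lambda>w. Ifz) (Arr N (Arr N (Arr N N)))"
    and eq: "ev.sem \<Gamma> (eq_test i) (\<lambda>w. eq_test i) (Arr N N)" for i
    by (auto simp: eq_test_def intro!: ev_sem_refl typing.intros)
  show "ev.sem \<Gamma> (chain bot_tm a (map (map_prod id exp_tm) bs))
      (\<lambda>w. chain (Num d) a' (map (map_prod id (exp_exc d)) bs)) N"
    using bs
  proof (induction bs)
    case Nil
    have "ev.sem \<Gamma> bot_tm (\<lambda>w. Num d) N"
      by (rule ev.sem_closedI) (auto simp: typed_pair_def typing_bot_tm bot intro: T_Num)
    then show ?case by simp
  next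
    case (Cons b bs)
    obtain i e where b: "b = (i, e)" by (cases b)
    have "ev.sem \<Gamma> (exp_tm e) (\<lambda>w. exp_exc d e) N"
      using Cons.prems b by auto
    moreover have "ev.sem \<Gamma> (chain bot_tm a (map (map_prod id exp_tm) bs))
      (\<lambda>w. chain (Num d) a' (map (map_prod id (exp_exc d)) bs)) N"
      using Cons by (auto simp: id_def)
    ultimately have "ev.sem \<Gamma>
        (App (App (App Ifz (App (eq_test i) a)) (exp_tm e)) (chain bot_tm a (map (map_prod id exp_tm) bs)))
        (\<lambda>w. App (App (App Ifz (App (eq_test i) a')) (exp_exc d e))
          (chain (Num d) a' (map (map_prod id (exp_exc d)) bs))) N"
      by (rule ev.sem_App[OF ev.sem_App[OF ev.sem_App[OF Ifz ev.sem_App[OF eq a]]]])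
    then show ?case by (simp add: b id_def)
  qed
qed simp

text \<open>The chain is treated as a whole because an equality test on \<open>d\<close> in general
  returns an answer that is neither \<open>d\<close> nor confirmed on the left. The value
  \<open>d\<close> fails all tests and reaches the default; any other value is shared by both sides
  and selects the same branch.\<close>

lemma agree_exc_chain:
  assumes "agree_exc d l a a'"
    and "\<And>i x. (i, x) \<in> set bs \<Longrightarrow> i \<noteq> d \<and> agree_exc d l (e x) (e' x)"
  shows "agree_exc d l (chain bot_tm a (map (map_prod id e) bs))
    (\<lambda>w. chain (Num d) (a' w) (map (map_prod id (\<lambda>x. e' x w)) bs))"
  using assms(1)
proof (cases rule: agree_excE)
  case 1
  have "evals (chain (Num d) (a' d) (map (map_prod id (\<lambda>x. e' x d)) bs)) d"
    using assms(2)
  proof (induction bs)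
    case Nil
    then show ?case by (simp add: evals_Num)
  next
    case (Cons b bs)
    then have "d \<noteq> fst b" "evals (chain (Num d) (a' d) (map (map_prod id (\<lambda>x. e' x d)) bs)) d"
      by (cases b; fastforce)+
    then show ?case
      using evals_Ifz[OF evals_eq_test[OF 1, of "fst b"]] by (cases b) (simp add: id_def)
  qed
  then show ?thesis by (auto simp: agree_exc_def)
next
  case (2 n)
  show ?thesis
    using assms(2)
  proof (induction bs)
    case Nil
    then show ?case by (auto simp: agree_exc_def intro: evals_Num)
  next
    case (Cons b bs)
    obtain i x where b: "b = (i, x)" by (cases b)
    have IH: "agree_exc d l (chain bot_tm a (map (map_prod id e) bs))
        (\<lambda>w. chain (Num d) (a' w) (map (map_prod id (\<lambda>x. e' x w)) bs))"
      and x: "agree_exc d l (e x) (e' x)"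
      using Cons b by (auto simp: id_def)
    let ?r = "chain bot_tm a (map (map_prod id e) bs)"
    let ?r' = "\<lambda>w. chain (Num d) (a' w) (map (map_prod id (\<lambda>x. e' x w)) bs)"
    have "agree_exc d l (if n = i then e x else ?r) (\<lambda>w. if n = i then e' x w else ?r' w)"
      using IH x by simp
    then obtain m where m: "evals (if n = i then e' x d else ?r' d) m"
      "m = d \<or> evals (if n = i then e x else ?r) m"
      by (auto simp: agree_exc_def)
    have "evals (App (App (App Ifz (App (eq_test i) (a' d))) (e' x d)) (?r' d)) m"
      using evals_Ifz[OF evals_eq_test[OF 2(2), of i], of "e' x d" "?r' d" m] m(1)
      by (cases "n = i") simp_all
    moreover have "m = d \<or> evals (App (App (App Ifz (App (eq_test i) a)) (e x)) ?r) m"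
      using evals_Ifz[OF evals_eq_test[OF 2(3), of i], of "e x" ?r m] m(2)
      by (cases "n = i") auto
    ultimately show ?case unfolding agree_exc_def b by auto
  qed
qed

lemma exc_sem_nsp:
  assumes "typing \<Gamma> (nsp_tm p) T" and "d \<notin> nsp_labels p"
  shows "exc.sem d \<Gamma> (nsp_tm p) (\<lambda>w. nsp_exc d p) T"
proof (rule exc.sem_nsp(1)[where L = "- {d}", OF _ agree_exc_Num _ _ assms(1)])
  show "agree_exc d l bot_tm (\<lambda>w. Num d)" for l
    by (auto simp: agree_exc_def intro: evals_Num)
  show "nsp_labels p \<subseteq> - {d}" using assms(2) by auto
  fix \<Gamma> a a' and bs :: "(nat \<times> exp) list"
  assume a: "exc.sem d \<Gamma> a (\<lambda>w. a') N"
    and bs: "\<And>i e. (i, e) \<in> set bs \<Longrightarrow> i \<in> - {d} \<and> exc.sem d \<Gamma> (exp_tm e) (\<lambda>w. exp_exc d e) N"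
  let ?t = "chain bot_tm a (map (map_prod id exp_tm) bs)"
  let ?t' = "chain (Num d) a' (map (map_prod id (exp_exc d)) bs)"
  have "typing \<Gamma> ?t N" "typing \<Gamma> ?t' N"
    using a bs by (auto simp: exc.sem_def typing_bot_tm intro!: typing_chain T_Num)
  moreover have "agree_exc d l (inst \<sigma> 0 ?t) (\<lambda>w. inst (map (\<lambda>s. s w) \<sigma>') 0 ?t')"
    if env: "exc.env_rel d l \<Gamma> \<sigma> \<sigma>'" for l \<sigma> \<sigma>'
  proof -
    have "agree_exc d l (inst \<sigma> 0 a) (\<lambda>w. inst (map (\<lambda>s. s w) \<sigma>') 0 a')"
      using a env unfolding exc.sem_def exc.LR.simps by blast
    moreover have "i \<noteq> d \<and> agree_exc d l (inst \<sigma> 0 (exp_tm e)) (\<lambda>w. inst (map (\<lambda>s. s w) \<sigma>') 0 (exp_exc d e))"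
      if "(i, e) \<in> set bs" for i e
      using bs[OF that] env unfolding exc.sem_def exc.LR.simps by blast
    ultimately have "agree_exc d l
        (chain bot_tm (inst \<sigma> 0 a) (map (map_prod id (\<lambda>e. inst \<sigma> 0 (exp_tm e))) bs))
        (\<lambda>w. chain (Num d) (inst (map (\<lambda>s. s w) \<sigma>') 0 a')
          (map (map_prod id (\<lambda>e. inst (map (\<lambda>s. s w) \<sigma>') 0 (exp_exc d e))) bs))"
      by (rule agree_exc_chain)
    moreover have "inst \<sigma> 0 bot_tm = bot_tm" by (simp add: bot_tm_def)
    ultimately show ?thesis
      by (simp add: inst_chain prod.map_comp comp_def id_def)
  qed
  ultimately show "exc.sem d \<Gamma> ?t (\<lambda>w. ?t') N"
    by (simp add: exc.sem_def)
qed

section \<open>Contexts as functions, extensionality and separating tests\<close>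

section \<open>Observational order and equivalence\<close>

text \<open>Turns a context into the body of a test function. The new variable is the outermost one,
  so the rest of the context keeps its indices.\<close>

fun abs_hole :: "ctx \<Rightarrow> nat \<Rightarrow> tm" where
  "abs_hole Hole k = Var k"
| "abs_hole (CLam T C) k = Lam T (abs_hole C (Suc k))"
| "abs_hole (CAppL C t) k = App (abs_hole C k) t"
| "abs_hole (CAppR t C) k = App t (abs_hole C k)"

lemma abs_hole:
  assumes "typing [] M \<sigma>" and "typing \<Gamma> (plug C M) T"
  shows "typing (\<Gamma> @ [\<sigma>]) (abs_hole C (length \<Gamma>)) T"
    and "typing [] M' \<tau> \<Longrightarrow> subst (abs_hole C (length \<Gamma>)) M' (length \<Gamma>) = plug C M'"
proof -
  have "typing (\<Gamma> @ [\<sigma>]) (abs_hole C (length \<Gamma>)) T \<and>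
    (typing [] M' \<tau> \<longrightarrow> subst (abs_hole C (length \<Gamma>)) M' (length \<Gamma>) = plug C M')"
    using assms(2)
  proof (induction C arbitrary: \<Gamma> T)
    case Hole
    then have "T = \<sigma>" using assms(1) typing_closed typing_unique by fastforce
    then show ?case by (auto intro: T_Var)
  next
    case (CLam S C)
    then obtain U where "T = Arr S U" "typing (S # \<Gamma>) (plug C M) U"
      by (auto elim: typing_LamE)
    with CLam.IH[of "S # \<Gamma>" U] show ?case by (auto intro: T_Lam simp: lift_closed)
  next
    case (CAppL C t)
    then obtain S where "typing \<Gamma> (plug C M) (Arr S T)" "typing \<Gamma> t S"
      by (auto elim: typing_AppE)
    with CAppL.IH[of \<Gamma> "Arr S T"] show ?case
      by (auto intro: T_App[where T = S] typing_append simp: subst_typed)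
  next
    case (CAppR t C)
    then obtain S where "typing \<Gamma> t (Arr S T)" "typing \<Gamma> (plug C M) S"
      by (auto elim: typing_AppE)
    with CAppR.IH[of \<Gamma> S] show ?case
      by (auto intro: T_App[where T = S] typing_append simp: subst_typed)
  qed
  then show "typing (\<Gamma> @ [\<sigma>]) (abs_hole C (length \<Gamma>)) T"
    and "typing [] M' \<tau> \<Longrightarrow> subst (abs_hole C (length \<Gamma>)) M' (length \<Gamma>) = plug C M'"
    by auto
qed

lemma evals_App_Lam: "evals (App (Lam T b) a) n \<longleftrightarrow> evals (subst b a 0) n"
  by (rule evals_step_iff) (rule S_Beta)

text \<open>Contexts and functions test alike: applying \<open>h\<close> to the hole is a context,
  and a context filled with closed terms is a function of its hole.\<close>

lemma obseq_iff: "obseq \<sigma> M M' \<longleftrightarrow> sf_le \<sigma> M M' \<and> sf_le \<sigma> M' M"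
proof
  assume obs: "obseq \<sigma> M M'"
  then have ty: "typing [] M \<sigma>" "typing [] M' \<sigma>"
    by (auto simp: obseq_def closed_of_def)
  have "evals (App h M) n \<longleftrightarrow> evals (App h M') n" if "typing [] h (Arr \<sigma> N)" for h n
  proof -
    have "typing [] (plug (CAppR h Hole) M) N" "typing [] (plug (CAppR h Hole) M') N"
      using that ty by (auto intro: T_App)
    then have "evals (plug (CAppR h Hole) M) n \<longleftrightarrow> evals (plug (CAppR h Hole) M') n"
      using obs unfolding obseq_def by blast
    then show ?thesis by simp
  qed
  then show "sf_le \<sigma> M M' \<and> sf_le \<sigma> M' M"
    using ty by (auto simp: sf_le_def closed_of_def)
next
  assume le: "sf_le \<sigma> M M' \<and> sf_le \<sigma> M' M"
  then have ty: "typing [] M \<sigma>" "typing [] M' \<sigma>"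
    by (auto simp: sf_le_def closed_of_def)
  have "evals (plug C M) n \<longleftrightarrow> evals (plug C M') n" if "typing [] (plug C M) N" for C n
  proof -
    let ?h = "Lam \<sigma> (abs_hole C 0)"
    have "closed_of (Arr \<sigma> N) ?h"
      using abs_hole(1)[OF ty(1) that] by (auto simp: closed_of_def intro: T_Lam)
    then have "evals (App ?h M) n \<longleftrightarrow> evals (App ?h M') n"
      using le unfolding sf_le_def by blast
    then show ?thesis
      using abs_hole(2)[OF ty(1) that ty(1)] abs_hole(2)[OF ty(1) that ty(2)]
      by (simp add: evals_App_Lam)
  qed
  then show "obseq \<sigma> M M'"
    using ty by (auto simp: obseq_def closed_of_def)
qed

lemma sf_leD:
  "sf_le \<sigma> x x' \<Longrightarrow> typing [] h (Arr \<sigma> N) \<Longrightarrow> evals (App h x) n \<Longrightarrow> evals (App h x') n"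
  by (simp add: sf_le_def closed_of_def)

lemma sf_le_trans: "sf_le \<sigma> x y \<Longrightarrow> sf_le \<sigma> y z \<Longrightarrow> sf_le \<sigma> x z"
  by (simp add: sf_le_def)

lemma typing_idt: "typing \<Gamma> (idt \<sigma>) (Arr \<sigma> \<sigma>)"
  unfolding idt_def by (intro T_Lam T_Var) auto

lemma sf_le_N: "sf_le N x x' \<Longrightarrow> evals x n \<Longrightarrow> evals x' n"
proof -
  assume le: "sf_le N x x'" and "evals x n"
  then have "evals (App (idt N) x) n"
    by (simp add: idt_def evals_App_Lam)
  then have "evals (App (idt N) x') n"
    by (rule sf_leD[OF le typing_idt])
  then show "evals x' n"
    by (simp add: idt_def evals_App_Lam)
qed

lemma sf_le_App:
  assumes le: "sf_le (Arr \<sigma> \<tau>) F G" and a: "typing [] a \<sigma>"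
  shows "sf_le \<tau> (App F a) (App G a)"
proof -
  have ty: "typing [] F (Arr \<sigma> \<tau>)" "typing [] G (Arr \<sigma> \<tau>)"
    using le by (auto simp: sf_le_def closed_of_def)
  have "evals (App h (App G a)) n" if h: "typing [] h (Arr \<tau> N)" "evals (App h (App F a)) n" for h n
  proof -
    \<comment> \<open>This test evaluates at \<open>a\<close> and then applies
      \<open>h\<close>.\<close>
    let ?h = "Lam (Arr \<sigma> \<tau>) (App h (App (Var 0) a))"
    have "typing [Arr \<sigma> \<tau>] (App (Var 0) a) \<tau>"
      by (rule T_App[OF _ typing_closed[OF a]]) (simp add: T_Var)
    then have "typing [] ?h (Arr (Arr \<sigma> \<tau>) N)"
      by (intro T_Lam T_App[OF typing_closed[OF h(1)]])
    moreover have "evals (App ?h M) n \<longleftrightarrow> evals (App h (App M a)) n" for M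
      using a h(1) by (simp add: evals_App_Lam subst_closed)
    ultimately show ?thesis using sf_leD[OF le] h(2) by blast
  qed
  then show ?thesis
    using ty a by (auto simp: sf_le_def closed_of_def intro: T_App)
qed

text \<open>Enlarging the right-hand side keeps convergence at type \<open>N\<close>, and
  \<open>sf_le_App\<close> carries this to function types.\<close>

lemma ev_LR_sf_le: "ev.LR l T t t' \<Longrightarrow> (\<And>w. sf_le T (t' w) (t'' w)) \<Longrightarrow> ev.LR l T t t''"
proof (induction T arbitrary: l t t' t'')
  case N
  have "agree_ev l t t''"
    unfolding agree_ev_def
  proof (intro allI impI)
    fix i n
    assume "i \<le> l" "(step ^^ i) t (Num n)"
    moreover have "agree_ev l t t'" using N.prems(1) by simp
    ultimately have "\<forall>\<^sub>F w in at_top. evals (t' w) n"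
      by (simp add: agree_ev_def)
    then show "\<forall>\<^sub>F w in at_top. evals (t'' w) n"
      by eventually_elim (rule sf_le_N[OF N.prems(2)])
  qed
  then show ?case by simp
next
  case (Arr T U)
  have "ev.LR l' U (App t a) (\<lambda>w. App (t'' w) (a' w))"
    if "l' \<le> l" "typed_pair T a a'" "ev.LR l' T a a'" for l' a a'
  proof (rule Arr.IH(2))
    show "ev.LR l' U (App t a) (\<lambda>w. App (t' w) (a' w))"
      using Arr.prems(1) that by simp
    show "sf_le U (App (t' w) (a' w)) (App (t'' w) (a' w))" for w
      using Arr.prems(2) that(2) by (auto simp: typed_pair_def intro: sf_le_App)
  qed
  then show ?case by simp
qed

text \<open>Every test \<open>h\<close> is related to itself, so it sends related arguments to
  related programs of type \<open>N\<close>.\<close>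

lemma ev_LR_imp_sf_le:
  assumes "typing [] x \<sigma>" and "typing [] x' \<sigma>" and "\<And>l. ev.LR l \<sigma> x (\<lambda>w. x')"
  shows "sf_le \<sigma> x x'"
proof -
  have "evals (App h x') n" if "typing [] h (Arr \<sigma> N)" "evals (App h x) n" for h n
  proof -
    have "ev.LR l N (App h x) (\<lambda>w. App h x')" for l
      using ev.sem_closedD(2)[OF ev_sem_refl[OF that(1)]] assms
      by (intro ev.LR_App[where T = \<sigma>]) (auto simp: typed_pair_def)
    then have "agree_ev l (App h x) (\<lambda>w. App h x')" for l by simp
    then have "\<forall>\<^sub>F w::nat in at_top. evals (App h x') n"
      using that(2) by (rule agree_evD)
    then show ?thesis by simp
  qed
  then show ?thesis using assms by (simp add: sf_le_def closed_of_def)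
qed

text \<open>If the test converged on \<open>f\<close> at all, monotonicity and uniqueness of values
  would make the result \<open>n\<close>, which is excluded.\<close>

lemma sf_less_separated:
  assumes "sf_less \<sigma> f f'"
  obtains h n where "typing [] h (Arr \<sigma> N)" and "evals (App h f') n" and "\<forall>m. \<not> evals (App h f) m"
proof -
  have le: "sf_le \<sigma> f f'" and "\<not> sf_le \<sigma> f' f"
    using assms by (auto simp: sf_less_def obseq_iff)
  then obtain h n where h: "typing [] h (Arr \<sigma> N)" "evals (App h f') n" "\<not> evals (App h f) n"
    unfolding sf_le_def closed_of_def by blast
  moreover have "\<forall>m. \<not> evals (App h f) m"
    using sf_leD[OF le h(1)] evals_unique[OF h(2)] h(3) by blast
  ultimately show thesis using that by blast
qed

lemma sf_le_App_idt: "typing [] f \<sigma> \<Longrightarrow> sf_le \<sigma> f (App (idt \<sigma>) f)"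
proof (rule ev_LR_imp_sf_le)
  assume f: "typing [] f \<sigma>"
  then show "typing [] (App (idt \<sigma>) f) \<sigma>"
    by (rule T_App[OF typing_idt])
  have "step (App (idt \<sigma>) f) f"
    using S_Beta[of \<sigma> "Var 0" f] by (simp add: idt_def)
  then show "ev.LR l \<sigma> f (\<lambda>w. App (idt \<sigma>) f)" for l
    by (intro ev.LR_steps_right[OF ev.sem_closedD(2)[OF ev_sem_refl[OF f]]] always_eventually
        allI r_into_rtranclp)
qed


section \<open>Incompatible extensions of finite elements, and rigidity of the identity\<close>

section \<open>Finite elements and super-identities\<close>

lemma evals_exc_App:
  assumes "typing [] h (Arr \<sigma> N)" and "exc.sem d [] f f' \<sigma>" and "\<forall>m. \<not> evals (App h f) m"
  shows "evals (App (map_const (exc_const d) h) (f' d)) d"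
proof -
  have "exc.LR d 0 N (App h f) (\<lambda>w. App (map_const (exc_const w) h) (f' w))"
    using exc.sem_closedD[OF exc_sem_exc[OF assms(1), of d]] exc.sem_closedD[OF assms(2)]
    by (intro exc.LR_App[where T = \<sigma>])
  then show ?thesis using assms(3) by (auto simp: agree_exc_def)
qed

lemma evals_ev_exc_App:
  assumes "typing [] h (Arr \<sigma> N)" and "ev.sem [] f f' \<sigma>" and "evals (App h f) n"
  shows "\<forall>\<^sub>F d in at_top. evals (App (map_const (exc_const d) h) (f' d)) n"
proof -
  have "ev.LR l N (App h f) (\<lambda>d. App (map_const (exc_const d) h) (f' d))" for l
    using ev.sem_closedD[OF ev_sem_exc[OF assms(1)]] ev.sem_closedD[OF assms(2)]
    by (intro ev.LR_App[where T = \<sigma>])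
  then have "agree_ev l (App h f) (\<lambda>d. App (map_const (exc_const d) h) (f' d))" for l by simp
  then show ?thesis using assms(3) by (rule agree_evD)
qed

lemma typing_exc: "typing [] t T \<Longrightarrow> typing [] (map_const (exc_const d) t) T"
  using ev_sem_exc[of "[]" t T] by (simp add: ev.sem_def)

lemma finite_not_maximal:
  assumes "sf_fin \<sigma> f" and "sf_less \<sigma> f f'"
  shows "\<exists>f''. closed_of \<sigma> f'' \<and> sf_incompat \<sigma> f'' f' \<and> sf_less \<sigma> f f''"
proof -
  obtain p where p: "typing [] (nsp_tm p) \<sigma>" "sf_le \<sigma> f (nsp_tm p)" "sf_le \<sigma> (nsp_tm p) f"
    using assms(1) by (auto simp: sf_fin_def closed_of_def obseq_iff)
  have le: "sf_le \<sigma> f f'" and f': "typing [] f' \<sigma>"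
    using assms(2) by (auto simp: sf_less_def sf_le_def closed_of_def)
  obtain h n where h: "typing [] h (Arr \<sigma> N)" "evals (App h f') n" "\<forall>m. \<not> evals (App h f) m"
    using assms(2) by (rule sf_less_separated)
  \<comment> \<open>Only the test is translated; \<open>f'\<close> enters as a constant family
    related to itself.\<close>
  have "\<forall>\<^sub>F d in at_top. evals (App (map_const (exc_const d) h) f') n"
    by (rule evals_ev_exc_App[OF h(1) ev_sem_refl[OF f'] h(2)])
  moreover have "\<forall>\<^sub>F d in at_top. n < d"
    by (rule eventually_gt_at_top)
  moreover have "\<forall>\<^sub>F d in at_top. d \<notin> nsp_labels p"
    using eventually_gt_at_top[of "Max (nsp_labels p)"]
    by eventually_elim (use Max_ge[OF finite_labels(1)] in fastforce)
  ultimately have "\<forall>\<^sub>F d in at_top. evals (App (map_const (exc_const d) h) f') n \<and> n < d \<and> d \<notin> nsp_labels p"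
    by eventually_elim simp
  then obtain d where d: "evals (App (map_const (exc_const d) h) f') n" "n < d" "d \<notin> nsp_labels p"
    by (auto dest: eventually_happens)
  let ?h = "map_const (exc_const d) h" and ?f = "nsp_exc d p"
  have h': "typing [] ?h (Arr \<sigma> N)"
    using h(1) by (rule typing_exc)
  \<comment> \<open>The procedure lies below \<open>f\<close>, so the test diverges on it
    too.\<close>
  have "\<forall>m. \<not> evals (App h (nsp_tm p)) m"
    using sf_leD[OF p(3) h(1)] h(3) by blast
  then have f'': "evals (App ?h ?f) d"
    using evals_exc_App[OF h(1) exc_sem_nsp[OF p(1) d(3)]] by simp
  have "typed_pair \<sigma> (nsp_tm p) (\<lambda>w. ?f)" "\<And>l. ev.LR l \<sigma> (nsp_tm p) (\<lambda>w. ?f)"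
    using ev.sem_closedD[OF ev_sem_nsp[OF p(1)]] by auto
  then have "sf_le \<sigma> (nsp_tm p) ?f" and ty: "typing [] ?f \<sigma>"
    by (auto simp: typed_pair_def intro: ev_LR_imp_sf_le)
  then have le': "sf_le \<sigma> f ?f"
    using p(2) sf_le_trans by blast
  have inc: "sf_incompat \<sigma> ?f f'"
    unfolding sf_incompat_def
  proof clarify
    fix g
    assume "sf_le \<sigma> ?f g" "sf_le \<sigma> f' g"
    \<comment> \<open>At a common upper bound the translated test would return both \<open>d\<close>
      and \<open>n\<close>.\<close>
    then have "evals (App ?h g) d" "evals (App ?h g) n"
      using sf_leD h' f'' d(1) by blast+
    then show False using evals_unique d(2) by blast
  qed
  \<comment> \<open>Otherwise \<open>f'\<close> itself would be a common upper bound.\<close>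
  have "\<not> sf_le \<sigma> ?f f"
  proof
    assume "sf_le \<sigma> ?f f"
    then have "sf_le \<sigma> ?f f'" using le sf_le_trans by blast
    moreover have "sf_le \<sigma> f' f'" using f' by (simp add: sf_le_def closed_of_def)
    ultimately show False using inc f' by (auto simp: sf_incompat_def closed_of_def)
  qed
  then have "sf_less \<sigma> f ?f" using le' by (simp add: sf_less_def obseq_iff)
  with inc ty show ?thesis by (auto simp: closed_of_def)
qed

lemma super_identity_fixes:
  assumes \<Phi>: "typing [] \<Phi> (Arr \<sigma> \<sigma>)" and le: "sf_le (Arr \<sigma> \<sigma>) (idt \<sigma>) \<Phi>"
  shows "\<not> sf_less \<sigma> f (App \<Phi> f)"
proof
  assume less: "sf_less \<sigma> f (App \<Phi> f)"
  then have f: "typing [] f \<sigma>"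
    by (auto simp: sf_less_def sf_le_def closed_of_def)
  obtain h n where h: "typing [] h (Arr \<sigma> N)" "evals (App h (App \<Phi> f)) n" "\<forall>m. \<not> evals (App h f) m"
    using less by (rule sf_less_separated)
  \<comment> \<open>\<open>\<Phi>\<close> stays untranslated so that its comparison with the
    identity applies at the translated \<open>f\<close>. The translated \<open>f\<close> need not
    lie above \<open>f\<close>, and no such comparison is made.\<close>
  have "\<forall>\<^sub>F d in at_top. evals (App (map_const (exc_const d) h) (App \<Phi> (map_const (exc_const d) f))) n"
    by (rule evals_ev_exc_App[OF h(1) ev.sem_App[OF ev_sem_refl[OF \<Phi>] ev_sem_exc[OF f]] h(2)])
  moreover have "\<forall>\<^sub>F d in at_top. n < d"
    by (rule eventually_gt_at_top)
  ultimately have "\<forall>\<^sub>F d in at_top.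
      evals (App (map_const (exc_const d) h) (App \<Phi> (map_const (exc_const d) f))) n \<and> n < d"
    by eventually_elim simp
  then obtain d where d: "evals (App (map_const (exc_const d) h) (App \<Phi> (map_const (exc_const d) f))) n"
    "n < d"
    by (auto dest: eventually_happens)
  let ?h = "map_const (exc_const d) h" and ?f = "map_const (exc_const d) f"
  have ty: "typing [] ?h (Arr \<sigma> N)" "typing [] ?f \<sigma>"
    using h(1) f by (auto intro: typing_exc)
  have "evals (App ?h ?f) d"
    using evals_exc_App[OF h(1) exc_sem_exc[OF f] h(3)] .
  moreover have "sf_le \<sigma> ?f (App \<Phi> ?f)"
    using sf_le_App_idt[OF ty(2)] sf_le_App[OF le ty(2)] by (rule sf_le_trans)
  ultimately have "evals (App ?h (App \<Phi> ?f)) d"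
    using sf_leD ty(1) by blast
  then show False using evals_unique d by blast
qed

lemma super_identity_eq:
  assumes \<Phi>: "typing [] \<Phi> (Arr \<sigma> \<sigma>)" and le: "sf_le (Arr \<sigma> \<sigma>) (idt \<sigma>) \<Phi>"
  shows "obseq (Arr \<sigma> \<sigma>) \<Phi> (idt \<sigma>)"
proof -
  have fixed: "sf_le \<sigma> (App \<Phi> f) f" if "typing [] f \<sigma>" for f
  proof -
    have "sf_le \<sigma> f (App \<Phi> f)"
      using sf_le_App_idt[OF that] sf_le_App[OF le that] by (rule sf_le_trans)
    then show ?thesis
      using super_identity_fixes[OF assms, of f] by (auto simp: sf_less_def obseq_iff)
  qed
  \<comment> \<open>Related arguments make \<open>App \<Phi> a\<close> related to
    \<open>App \<Phi> (a' w)\<close>, which lies below \<open>a' w\<close> by \<open>fixed\<close>;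
    and the identity applied to \<open>a' w\<close> reduces to \<open>a' w\<close>.\<close>
  have "ev.LR l \<sigma> (App \<Phi> a) (\<lambda>w. App (idt \<sigma>) (a' w))"
    if a: "typed_pair \<sigma> a a'" "ev.LR l \<sigma> a a'" for l a a'
  proof (rule ev.LR_steps_right)
    have "ev.LR l \<sigma> (App \<Phi> a) (\<lambda>w. App \<Phi> (a' w))"
      using ev.sem_closedD(2)[OF ev_sem_refl[OF \<Phi>]] a by (intro ev.LR_App[where T = \<sigma>])
    then show "ev.LR l \<sigma> (App \<Phi> a) a'"
      by (rule ev_LR_sf_le) (use a(1) in \<open>auto simp: typed_pair_def intro: fixed\<close>)
    have "step (App (idt \<sigma>) (a' w)) (a' w)" for w
      using S_Beta[of \<sigma> "Var 0" "a' w"] by (simp add: idt_def)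
    then show "\<forall>\<^sub>F w in at_top. step\<^sup>*\<^sup>* (App (idt \<sigma>) (a' w)) (a' w)"
      by (intro always_eventually allI r_into_rtranclp)
  qed
  then have "sf_le (Arr \<sigma> \<sigma>) \<Phi> (idt \<sigma>)"
    using \<Phi> typing_idt by (intro ev_LR_imp_sf_le) simp_all
  then show ?thesis using le by (simp add: obseq_iff)
qed

theorem theoremA1:
  fixes k :: nat
  shows "(\<forall>f f'. sf_fin (pure k) f \<and> closed_of (pure k) f' \<and> sf_less (pure k) f f' \<longrightarrow>
            (\<exists>f''. closed_of (pure k) f'' \<and> sf_incompat (pure k) f'' f' \<and> sf_less (pure k) f f''))
       \<and> (\<forall>\<Phi>. closed_of (Arr (pure k) (pure k)) \<Phi> \<and> sf_le (Arr (pure k) (pure k)) (idt (pure k)) \<Phi> \<longrightarrow>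
            \<not> (\<exists>f. closed_of (pure k) f \<and> sf_less (pure k) f (App \<Phi> f))
            \<and> obseq (Arr (pure k) (pure k)) \<Phi> (idt (pure k)))"
  using finite_not_maximal super_identity_fixes super_identity_eq
  unfolding closed_of_def by blast

end
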